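(* Let $\lambda$ be chosen uniformly at random from the set $\Pi(n)$ of all set partitions of $[n]=\{1,\dots,n\}$, and let $L(\lambda)$ be the number of levels of $\lambda$. Then $$\mu_n^L = \mathbb{E}(L(\lambda)) = (n-1)\frac{B_{n-1}}{B_n}\sim \log(n),$$ $$(\sigma_n^L)^2 = \mathrm{VAR}(L(\lambda)) = (n-1)\frac{B_{n-1}}{B_n} + n(n-1)\frac{B_{n-2}}{B_n} - (n-1)^2\frac{B_{n-1}^2}{B_n^2}\sim\log(n).$$ Normalized by its mean and standard deviation, $L(\lambda)$ has an approximate standard normal distribution: $$\mathbf{P}\left(\frac{L(\lambda)-\mu_n^L}{\sigma_n^L}\le x\right)\longrightarrow \frac{1}{\sqrt{2\pi}}\int_{-\infty}^x e^{-\tau^2/2}\,d\tau$$ for all fixed $x$ as $n\to\infty$.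
   Context: $B_n=|\Pi(n)|$ is the $n$th Bell number. A set partition $\lambda$ of $[n]$ is coded as a sequence $x_1,x_2,\dots,x_n$, where $x_i=j$ if and only if $i$ belongs to block $j$ of $\lambda$, the blocks being numbered $1,2,3,\dots$ in increasing order of their smallest elements (for example, $135|24|6|7$ is coded as $1,2,1,2,1,3,4$). The number of levels of $\lambda$ is $L(\lambda)=|\{i : x_{i+1}=x_i\}|$, where $1\le i\le n-1$. The notation $a_n\sim b_n$ means $a_n/b_n\to1$ as $n\to\infty$.
   Formalization: The middle term of the variance is corrected from n(n-1)B_{n-2}/B_n to (n-1)(n-2)B_{n-2}/B_n; the printed formula is false for every n ≥ 2 (for n = 2 it gives 5/4, while the variance is 1/4). *)

theory Defs
  imports "HOL-Probability.Probability" "HOL-Library.Disjoint_Sets" "HOL-Library.Landau_Symbols"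
begin

definition set_partitions :: "nat \<Rightarrow> nat set set set" where
  "set_partitions n = {P. partition_on {1..n} P}"

definition bell :: "nat \<Rightarrow> nat" where
  "bell n = card (set_partitions n)"

text \<open>Blocks are numbered 1, 2, 3, \<dots> in increasing order of their smallest elements, so the
  number of a block is its rank.\<close>

definition block_number :: "nat set set \<Rightarrow> nat set \<Rightarrow> nat" where
  "block_number P B = card {C \<in> P. Min C \<le> Min B}"

definition partition_code :: "nat set set \<Rightarrow> nat \<Rightarrow> nat" where
  "partition_code P i = (THE j. \<exists>B\<in>P. i \<in> B \<and> block_number P B = j)"

definition levels :: "nat \<Rightarrow> nat set set \<Rightarrow> nat" where
  "levels n P = card {i. 1 \<le> i \<and> i \<le> n - 1 \<and> partition_code P (i + 1) = partition_code P i}"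

definition uniform_partition :: "nat \<Rightarrow> nat set set pmf" where
  "uniform_partition n = pmf_of_set (set_partitions n)"

definition level_mean :: "nat \<Rightarrow> real" where
  "level_mean n = measure_pmf.expectation (uniform_partition n) (\<lambda>P. real (levels n P))"

definition level_variance :: "nat \<Rightarrow> real" where
  "level_variance n = measure_pmf.variance (uniform_partition n) (\<lambda>P. real (levels n P))"

definition level_sd :: "nat \<Rightarrow> real" where
  "level_sd n = sqrt (level_variance n)"

text \<open>The set of partitions is finite and nonempty, so \<^term>\<open>pmf_of_set\<close> really is
  the uniform distribution on it.\<close>

lemma finite_set_partitions: "finite (set_partitions n)"
  unfolding set_partitions_def by (rule finitely_many_partition_on) simp

lemma set_partitions_nonempty: "set_partitions n \<noteq> {}"
proof (cases "n = 0")
  case True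
  then have "{} \<in> set_partitions n"
    by (simp add: set_partitions_def partition_on_def)
  then show ?thesis by blast
next
  case False
  then have "{{1..n}} \<in> set_partitions n"
    by (simp add: set_partitions_def partition_on_def)
  then show ?thesis by blast
qed

lemma partition_code_eq:
  assumes "partition_on A P" "B \<in> P" "i \<in> B"
  shows "partition_code P i = block_number P B"
  unfolding partition_code_def
proof (rule the_equality)
  show "\<exists>C\<in>P. i \<in> C \<and> block_number P C = block_number P B"
    using assms by blast
  show "j = block_number P B" if "\<exists>C\<in>P. i \<in> C \<and> block_number P C = j" for j
    using that assms by (metis IntI disjointD empty_iff partition_onD2)
qed

text \<open>The partition \<open>135|24|6|7\<close> has code \<open>1,2,1,2,1,3,4\<close>.\<close>

lemma partition_code_example:
  defines "P \<equiv> {{1,3,5},{2,4},{6},{7}} :: nat set set"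
  shows "map (partition_code P) [1,2,3,4,5,6,7] = [1,2,1,2,1,3,4]"
proof -
  have P: "partition_on {1,2,3,4,5,6,7} P"
    unfolding P_def partition_on_def disjoint_def by auto
  have mn: "Min {1,3,5::nat} = 1" "Min {2,4::nat} = 2"
    by simp_all
  have ne: "{1,3,5::nat} \<noteq> {2,4}" "{1,3,5::nat} \<noteq> {6}" "{1,3,5::nat} \<noteq> {7}"
    "{2,4::nat} \<noteq> {6}" "{2,4::nat} \<noteq> {7}"
    by auto
  have "{C\<in>P. Min C \<le> 1} = {{1,3,5}}" "{C\<in>P. Min C \<le> 2} = {{1,3,5},{2,4}}"
    "{C\<in>P. Min C \<le> 6} = {{1,3,5},{2,4},{6}}" "{C\<in>P. Min C \<le> 7} = {{1,3,5},{2,4},{6},{7}}"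
    unfolding P_def by (auto simp: mn)
  then have b: "block_number P {1,3,5} = 1" "block_number P {2,4} = 2"
    "block_number P {6} = 3" "block_number P {7} = 4"
    using ne by (simp_all add: block_number_def mn)
  have mem: "{1,3,5} \<in> P" "{2,4} \<in> P" "{6} \<in> P" "{7} \<in> P"
    by (simp_all add: P_def)
  show ?thesis
    using partition_code_eq[OF P mem(1)] partition_code_eq[OF P mem(2)]
      partition_code_eq[OF P mem(3)] partition_code_eq[OF P mem(4)] b
    by simp
qed

end

theory Submission
  imports Defs "HOL-Real_Asymp.Real_Asymp"
begin

text \<open>
  Write \<open>n = N + 1\<close>.  Everything rests on one generalisation of Dobinski's formula,
  \[ \sum_{j \ge 0} \frac{(j+z)^N}{j!} = e \sum_{\lambda \in \Pi(n)} z^{L(\lambda)} , \]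
  proved by counting the functions from \<open>{1..n}\<close> to an \<open>x\<close>-element set according to the partition
  into fibres.  A level of that partition is a position where the function repeats its value, so
  counting position by position gives \<open>x (x - 1 + z) ^ N\<close>, while a partition with \<open>k\<close> blocks is the
  fibre partition of \<open>x (x - 1) \<dots> (x - k + 1)\<close> functions; dividing by \<open>x!\<close> and summing over \<open>x\<close>
  turns each of these falling factorials into \<open>e\<close>.

  Putting \<open>z = 1 + y\<close> and comparing coefficients of \<open>y\<close> gives all binomial moments of the number of
  levels, hence the exact mean and variance.  Putting \<open>z\<close> on the unit circle exhibits the number of
  levels as a mixture: if \<open>M\<close> has weights proportional to \<open>m ^ n / m!\<close>, then \<open>L\<close> is
  binomial with parameters \<open>N\<close> and \<open>1 / M\<close>.  Since \<open>E(M) = B (n + 1) / B n\<close> and, for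
  \<open>N \<ge> 2\<close>, \<open>E(1 / M) = B N / B n\<close> and \<open>E(1 / M\<^sup>2) = B (N - 1) / B n\<close>, all that is needed about \<open>M\<close>
  is contained in the ratios \<open>R k = B (k + 1) / B k\<close> of consecutive Bell numbers:

  \<^item> these ratios increase, by at most 1 in each step (the latter says that the variance of \<open>M\<close>
    is at most its mean), so that the variance of \<open>N / M\<close> tends to 0;
  \<^item> two applications of Jensen's inequality squeeze \<open>R = R (N + 1)\<close> by
    \<open>(R - 1) ln (R - 1) \<le> N \<le> (R + 1) ln (R - 1)\<close>, so that \<open>N / R\<close> is asymptotic to \<open>ln N\<close>.

  Hence mean and variance are both asymptotic to \<open>ln n\<close>.  As \<open>M\<close> is concentrated and large, the
  number of levels is close to a Poisson variable with the same mean \<open>\<mu>\<close>, with an explicit error bound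
  for the generating functions on the unit disc (\<open>poisson_approximation\<close>).  A Poisson variable with
  mean tending to infinity is asymptotically normal, and Levy's continuity theorem carries this over
  to the normalised number of levels.
\<close>

section \<open>Functions and their fibre partitions\<close>

definition fibres :: "('a \<Rightarrow> 'b) \<Rightarrow> 'a set \<Rightarrow> 'a set set" where
  "fibres f X = (\<lambda>x. {y\<in>X. f y = f x}) ` X"

lemma partition_on_fibres: "partition_on X (fibres f X)"
  by (rule partition_onI) (auto simp: fibres_def disjnt_def)

text \<open>A function with fibre partition \<open>P\<close> is the same thing as a choice of distinct values for the
  blocks of \<open>P\<close>.\<close>

lemma card_functions_with_fibres:
  assumes P: "partition_on X P"
  shows "card {f \<in> X \<rightarrow>\<^sub>E Y. fibres f X = P} = card {g \<in> P \<rightarrow>\<^sub>E Y. inj_on g P}"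
proof -
  define blk where "blk x = (THE B. B \<in> P \<and> x \<in> B)" for x
  have uniq: "B = C" if "B \<in> P" "C \<in> P" "x \<in> B" "x \<in> C" for B C x
    using that P by (metis IntI disjointD empty_iff partition_onD2)
  have blk_eq: "blk x = B" if "B \<in> P" "x \<in> B" for x B
    unfolding blk_def using that uniq by (intro the_equality) auto
  have blk: "blk x \<in> P" "x \<in> blk x" if x: "x \<in> X" for x
  proof -
    obtain B where "B \<in> P" "x \<in> B" using x partition_onD1[OF P] by blast
    then show "blk x \<in> P" "x \<in> blk x" using blk_eq by auto
  qed
  have sub: "x \<in> X" if "B \<in> P" "x \<in> B" for x B
    using that partition_onD1[OF P] by blast
  define rep :: "'a set \<Rightarrow> 'a" where "rep B = (SOME x. x \<in> B)" for B
  have rep: "rep B \<in> B" if "B \<in> P" for B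
    using that partition_onD3[OF P] unfolding rep_def by (metis ex_in_conv someI_ex)
  have fib_same: "f x = f y \<longleftrightarrow> blk x = blk y"
    if f: "fibres f X = P" and xy: "x \<in> X" "y \<in> X" for f :: "'a \<Rightarrow> 'b" and x y
  proof -
    have "{u\<in>X. f u = f x} \<in> P" "x \<in> {u\<in>X. f u = f x}"
      using f xy by (auto simp: fibres_def)
    then have "blk x = {u\<in>X. f u = f x}" by (rule blk_eq)
    moreover have "{u\<in>X. f u = f y} \<in> P" "y \<in> {u\<in>X. f u = f y}"
      using f xy by (auto simp: fibres_def)
    then have "blk y = {u\<in>X. f u = f y}" by (rule blk_eq)
    ultimately show ?thesis using xy by auto
  qed
  \<comment> \<open>A function is read off on representatives of the blocks; conversely, the value of a block is
    given to all its elements.\<close>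
  have "bij_betw (\<lambda>f. restrict (\<lambda>B. f (rep B)) P)
     {f \<in> X \<rightarrow>\<^sub>E Y. fibres f X = P} {g \<in> P \<rightarrow>\<^sub>E Y. inj_on g P}"
  proof (rule bij_betw_byWitness[where f' = "\<lambda>g. restrict (\<lambda>x. g (blk x)) X"])
    show "\<forall>f\<in>{f \<in> X \<rightarrow>\<^sub>E Y. fibres f X = P}.
        restrict (\<lambda>x. restrict (\<lambda>B. f (rep B)) P (blk x)) X = f"
    proof (intro ballI ext)
      fix f x assume f: "f \<in> {f \<in> X \<rightarrow>\<^sub>E Y. fibres f X = P}"
      show "restrict (\<lambda>x. restrict (\<lambda>B. f (rep B)) P (blk x)) X x = f x"
      proof (cases "x \<in> X")
        case True
        then have "f (rep (blk x)) = f x"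
          using f rep[OF blk(1)] blk_eq sub[OF blk(1)] blk(1) by (subst fib_same) auto
        then show ?thesis using True blk by simp
      qed (use f in \<open>auto simp: PiE_def extensional_def\<close>)
    qed
    show "\<forall>g\<in>{g \<in> P \<rightarrow>\<^sub>E Y. inj_on g P}.
        restrict (\<lambda>B. restrict (\<lambda>x. g (blk x)) X (rep B)) P = g"
    proof (intro ballI ext)
      fix g B assume g: "g \<in> {g \<in> P \<rightarrow>\<^sub>E Y. inj_on g P}"
      show "restrict (\<lambda>B. restrict (\<lambda>x. g (blk x)) X (rep B)) P B = g B"
      proof (cases "B \<in> P")
        case True
        then have "blk (rep B) = B" "rep B \<in> X" using rep blk_eq sub by auto
        then show ?thesis using True by simp
      qed (use g in \<open>auto simp: PiE_def extensional_def\<close>)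
    qed
    show "(\<lambda>f. restrict (\<lambda>B. f (rep B)) P) ` {f \<in> X \<rightarrow>\<^sub>E Y. fibres f X = P}
        \<subseteq> {g \<in> P \<rightarrow>\<^sub>E Y. inj_on g P}"
    proof clarify
      fix f assume f: "f \<in> X \<rightarrow>\<^sub>E Y" "P = fibres f X"
      have "restrict (\<lambda>B. f (rep B)) P \<in> P \<rightarrow>\<^sub>E Y"
        using f rep sub by (auto simp del: f(2))
      moreover have "inj_on (restrict (\<lambda>B. f (rep B)) P) P"
      proof (rule inj_onI)
        fix B C assume BC: "B \<in> P" "C \<in> P"
          "restrict (\<lambda>B. f (rep B)) P B = restrict (\<lambda>B. f (rep B)) P C"
        then have "blk (rep B) = blk (rep C)"
          using fib_same[OF f(2)[symmetric], of "rep B" "rep C"] rep sub by auto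
        then show "B = C" using BC rep blk_eq by metis
      qed
      ultimately show "restrict (\<lambda>B. f (rep B)) (fibres f X) \<in> fibres f X \<rightarrow>\<^sub>E Y
          \<and> inj_on (restrict (\<lambda>B. f (rep B)) (fibres f X)) (fibres f X)"
        using f(2) by simp
    qed
    show "(\<lambda>g. restrict (\<lambda>x. g (blk x)) X) ` {g \<in> P \<rightarrow>\<^sub>E Y. inj_on g P}
        \<subseteq> {f \<in> X \<rightarrow>\<^sub>E Y. fibres f X = P}"
    proof clarify
      fix g assume g: "g \<in> P \<rightarrow>\<^sub>E Y" "inj_on g P"
      have "{y \<in> X. restrict (\<lambda>x. g (blk x)) X y = restrict (\<lambda>x. g (blk x)) X x} = blk x"
        if x: "x \<in> X" for x
      proof -
        have "g (blk y) = g (blk x) \<longleftrightarrow> y \<in> blk x" if "y \<in> X" for y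
          using that x blk blk_eq inj_onD[OF g(2)] by metis
        then show ?thesis using x blk(1) sub by auto
      qed
      then have "fibres (restrict (\<lambda>x. g (blk x)) X) X = blk ` X"
        unfolding fibres_def by (intro image_cong) auto
      also have "\<dots> = P"
        using blk rep blk_eq sub by (auto simp: image_iff) metis
      finally show "restrict (\<lambda>x. g (blk x)) X \<in> X \<rightarrow>\<^sub>E Y
          \<and> fibres (restrict (\<lambda>x. g (blk x)) X) X = P"
        using g blk by auto
    qed
  qed
  then show ?thesis by (rule bij_betw_same_card)
qed

lemma finite_set_partition: "P \<in> set_partitions n \<Longrightarrow> finite P"
  unfolding set_partitions_def by (auto intro: finite_elements)

lemma sum_over_functions_by_fibres:
  fixes w :: "nat set set \<Rightarrow> 'a::real_normed_field"
  assumes "finite Y"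
  shows "(\<Sum>f\<in>{1..n} \<rightarrow>\<^sub>E Y. w (fibres f {1..n}))
       = (\<Sum>P\<in>set_partitions n. w P * of_nat (card {g \<in> P \<rightarrow>\<^sub>E Y. inj_on g P}))"
proof -
  let ?F = "{1..n} \<rightarrow>\<^sub>E Y"
  have "(\<Sum>f\<in>?F. w (fibres f {1..n}))
      = (\<Sum>P\<in>set_partitions n. \<Sum>f\<in>{f \<in> ?F. fibres f {1..n} = P}. w (fibres f {1..n}))"
    by (rule sum.group[symmetric])
       (use finite_set_partitions[of n] in
        \<open>auto simp: assms finite_PiE set_partitions_def partition_on_fibres\<close>)
  also have "\<dots> = (\<Sum>P\<in>set_partitions n. w P * of_nat (card {g \<in> P \<rightarrow>\<^sub>E Y. inj_on g P}))"
    by (intro sum.cong refl)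
       (auto simp: set_partitions_def card_functions_with_fibres mult.commute)
  finally show ?thesis .
qed

text \<open>There are \<open>x! / (x - k)!\<close> injections from a \<open>k\<close>-element set, so the series is the one for
  \<open>e\<close> with \<open>k\<close> zeros in front.\<close>

lemma injections_over_factorials_sums:
  fixes P :: "'a set"
  assumes "finite P"
  shows "(\<lambda>x. of_nat (card {g \<in> P \<rightarrow>\<^sub>E {..<x}. inj_on g P}) / fact x)
     sums (exp 1 :: 'b::{banach,real_normed_field})"
proof -
  define k where "k = card P"
  let ?c = "\<lambda>x. of_nat (card {g \<in> P \<rightarrow>\<^sub>E {..<x}. inj_on g P}) / fact x :: 'b"
  have c: "?c x = (if k \<le> x then inverse (fact (x - k)) else 0)" for x
  proof (cases "k \<le> x")
    case True
    have "card {g \<in> P \<rightarrow>\<^sub>E {..<x}. inj_on g P} = prod ((-) x) {0..<k}"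
      using card_inj_on_subset_funcset[of P "{..<x}" P] assms by (simp add: k_def)
    also have "of_nat \<dots> * fact (x - k) = (fact x :: 'b)"
      using True
    proof (induction k)
      case (Suc k)
      then have "(fact (x - k) :: 'b) = of_nat (x - k) * fact (x - Suc k)"
        by (metis Suc_diff_Suc Suc_le_eq fact_Suc)
      with Suc show ?case by (simp add: ac_simps)
    qed simp
    finally show ?thesis using True by (simp add: field_simps)
  next
    case False
    then have none: "{g \<in> P \<rightarrow>\<^sub>E {..<x}. inj_on g P} = {}"
      using card_inj[of _ P "{..<x}"] by (auto simp: k_def PiE_def)
    show ?thesis unfolding none using False by simp
  qed
  have "(\<lambda>n. ?c (n + k)) sums exp 1"
    using exp_converges[of "1::'b"] unfolding c by (simp add: scaleR_conv_of_real)
  then show ?thesis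
    by (subst (asm) sums_iff_shift) (simp add: c)
qed

text \<open>The series assigns the same mass \<open>e\<close> to every partition, whatever its number of blocks.  This is
  what turns sums over functions into unbiased sums over partitions.\<close>

lemma weighted_dobinski:
  fixes w :: "nat set set \<Rightarrow> 'a::{banach,real_normed_field}"
  shows "(\<lambda>x. (\<Sum>f\<in>{1..n} \<rightarrow>\<^sub>E {..<x}. w (fibres f {1..n})) / fact x)
     sums (exp 1 * (\<Sum>P\<in>set_partitions n. w P))"
proof -
  have "(\<lambda>x. \<Sum>P\<in>set_partitions n.
           w P * (of_nat (card {g \<in> P \<rightarrow>\<^sub>E {..<x}. inj_on g P}) / fact x))
     sums (\<Sum>P\<in>set_partitions n. w P * exp 1)"
    by (intro sums_sum sums_mult injections_over_factorials_sums finite_set_partition)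
  then show ?thesis
    by (subst sum_over_functions_by_fibres)
       (simp_all add: sum_divide_distrib sum_distrib_left mult.commute)
qed

text \<open>Dobinski's formula: the constant weight 1 counts all \<open>m ^ n\<close> functions.\<close>

lemma dobinski: "(\<lambda>m. real m ^ n / fact m) sums (exp 1 * real (bell n))"
  using weighted_dobinski[where w = "\<lambda>_. 1::real" and n = n] by (simp add: bell_def card_PiE)

section \<open>Levels and the exact moments\<close>

text \<open>The code only enters through the equality of neighbouring entries, and numbering the blocks by
  their minima is injective.\<close>

lemma partition_code_eq_iff:
  assumes P: "partition_on {1..n} P" and BC: "B \<in> P" "C \<in> P" "i \<in> B" "j \<in> C"
  shows "partition_code P i = partition_code P j \<longleftrightarrow> B = C"
proof -
  have fin: "finite P" by (rule finite_elements[OF _ P]) simp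
  have Min_in: "Min D \<in> D" if "D \<in> P" for D
  proof (rule Min_in)
    show "finite D" using that partition_onD1[OF P] by (metis Union_upper finite_atLeastAtMost finite_subset)
    show "D \<noteq> {}" using that partition_onD3[OF P] by auto
  qed
  have neq: "block_number P D < block_number P E" if "D \<in> P" "E \<in> P" "Min D < Min E" for D E
    unfolding block_number_def
    using that fin by (intro psubset_card_mono) (auto simp: psubset_eq set_eq_iff intro: exI[of _ E])
  have "block_number P B \<noteq> block_number P C" if "B \<noteq> C"
  proof -
    have "Min B \<noteq> Min C"
      using that Min_in BC partition_onD2[OF P] by (metis IntI disjointD empty_iff)
    then show ?thesis using neq BC by (metis less_irrefl linorder_neqE_nat)
  qed
  then show ?thesis
    using partition_code_eq[OF P BC(1,3)] partition_code_eq[OF P BC(2,4)] by auto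
qed

text \<open>Two neighbours share a block of the fibre partition precisely when the function agrees on them.\<close>

lemma levels_fibres: "levels n (fibres f {1..n}) = card {i \<in> {1..<n}. f (Suc i) = f i}"
proof -
  have "partition_code (fibres f {1..n}) (i + 1) = partition_code (fibres f {1..n}) i
      \<longleftrightarrow> f (Suc i) = f i" if i: "i \<in> {1..<n}" for i
  proof -
    let ?B = "\<lambda>i. {y \<in> {1..n}. f y = f i}"
    have "partition_code (fibres f {1..n}) (Suc i) = partition_code (fibres f {1..n}) i
      \<longleftrightarrow> ?B (Suc i) = ?B i"
      by (rule partition_code_eq_iff[OF partition_on_fibres]) (use i in \<open>auto simp: fibres_def\<close>)
    also have "\<dots> \<longleftrightarrow> f (Suc i) = f i"
    proof
      assume "?B (Suc i) = ?B i"
      moreover have "i \<in> ?B i" using i by auto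
      ultimately have "i \<in> ?B (Suc i)" by blast
      then show "f (Suc i) = f i" by simp
    qed simp
    finally show ?thesis by simp
  qed
  then have "{i. 1 \<le> i \<and> i \<le> n - 1 \<and> partition_code (fibres f {1..n}) (i + 1)
       = partition_code (fibres f {1..n}) i} = {i \<in> {1..<n}. f (Suc i) = f i}"
    by auto
  then show ?thesis by (simp add: levels_def)
qed

text \<open>Each position after the first offers one value that creates a level and \<open>card Y - 1\<close> values
  that do not.\<close>

lemma sum_power_levels_functions:
  fixes z :: "'a::real_normed_field"
  assumes "finite Y"
  shows "(\<Sum>f\<in>{1..Suc N} \<rightarrow>\<^sub>E Y. z ^ card {i \<in> {1..<Suc N}. f (Suc i) = f i})
       = of_nat (card Y) * (of_nat (card Y) - 1 + z) ^ N"
proof (induction N)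
  case 0
  have "card ({Suc 0} \<rightarrow>\<^sub>E Y) = card Y" by (simp add: card_PiE)
  then show ?case by simp
next
  case (Suc N)
  let ?n = "Suc (Suc N)"
  let ?lev = "\<lambda>n f. card {i \<in> {1..<n}. f (Suc i) = f i}"
  have "{1..?n} = insert ?n {1..Suc N}" by auto
  then have "(\<Sum>f\<in>{1..?n} \<rightarrow>\<^sub>E Y. z ^ ?lev ?n f)
      = (\<Sum>f\<in>(\<lambda>(y, g). g(?n := y)) ` (Y \<times> ({1..Suc N} \<rightarrow>\<^sub>E Y)). z ^ ?lev ?n f)"
    by (simp only: PiE_insert_eq)
  also have "\<dots> = (\<Sum>(y, g)\<in>Y \<times> ({1..Suc N} \<rightarrow>\<^sub>E Y). z ^ ?lev ?n (g(?n := y)))"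
    by (subst sum.reindex[OF inj_combinator]) (auto simp: case_prod_unfold)
  also have "\<dots> = (\<Sum>g\<in>{1..Suc N} \<rightarrow>\<^sub>E Y. \<Sum>y\<in>Y. z ^ ?lev ?n (g(?n := y)))"
    by (simp only: sum.cartesian_product[symmetric] sum.swap[of _ Y])
  also have "\<dots> = (\<Sum>g\<in>{1..Suc N} \<rightarrow>\<^sub>E Y. z ^ ?lev (Suc N) g * (of_nat (card Y) - 1 + z))"
  proof (rule sum.cong[OF refl])
    fix g assume g: "g \<in> {1..Suc N} \<rightarrow>\<^sub>E Y"
    then have gY: "g (Suc N) \<in> Y" by auto
    have "z ^ ?lev ?n (g(?n := y)) = z ^ ?lev (Suc N) g * (if y = g (Suc N) then z else 1)" for y
    proof -
      have "{i \<in> {1..<?n}. (g(?n := y)) (Suc i) = (g(?n := y)) i}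
          = {i \<in> {1..<Suc N}. g (Suc i) = g i} \<union> (if y = g (Suc N) then {Suc N} else {})"
        by (auto simp: less_Suc_eq)
      moreover have "Suc N \<notin> {i \<in> {1..<Suc N}. g (Suc i) = g i}" by simp
      ultimately show ?thesis by simp
    qed
    then have "(\<Sum>y\<in>Y. z ^ ?lev ?n (g(?n := y)))
        = z ^ ?lev (Suc N) g * (\<Sum>y\<in>Y. if y = g (Suc N) then z else 1)"
      by (simp only: sum_distrib_left)
    also have "(\<Sum>y\<in>Y. if y = g (Suc N) then z else 1)
        = z + (\<Sum>y\<in>Y - {g (Suc N)}. 1)"
      using gY assms by (simp add: sum.remove)
    also have "\<dots> = of_nat (card Y) - 1 + z"
      using gY assms card_gt_0_iff[of Y] by (auto simp: card_Diff_singleton of_nat_diff)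
    finally show "(\<Sum>y\<in>Y. z ^ ?lev ?n (g(?n := y)))
       = z ^ ?lev (Suc N) g * (of_nat (card Y) - 1 + z)" .
  qed
  also have "\<dots> = of_nat (card Y) * (of_nat (card Y) - 1 + z) ^ Suc N"
    unfolding sum_distrib_right[symmetric] Suc.IH by (simp add: mult_ac)
  finally show ?case .
qed

text \<open>The substitution \<open>x = j + 1\<close> cancels the factor \<open>x\<close> against \<open>x!\<close>.\<close>

lemma levels_dobinski:
  fixes z :: "'a::{banach,real_normed_field}"
  shows "(\<lambda>j. (of_nat j + z) ^ N / fact j)
     sums (exp 1 * (\<Sum>P\<in>set_partitions (Suc N). z ^ levels (Suc N) P))"
proof -
  have "(\<lambda>x. of_nat x * (of_nat x - 1 + z) ^ N / fact x)
     sums (exp 1 * (\<Sum>P\<in>set_partitions (Suc N). z ^ levels (Suc N) P))"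
    using weighted_dobinski[where w = "\<lambda>P. z ^ levels (Suc N) P" and n = "Suc N"]
    unfolding levels_fibres sum_power_levels_functions[OF finite_lessThan] card_lessThan .
  then have "(\<lambda>j. of_nat (Suc j) * (of_nat (Suc j) - 1 + z) ^ N / fact (Suc j))
     sums (exp 1 * (\<Sum>P\<in>set_partitions (Suc N). z ^ levels (Suc N) P))"
    by (subst sums_Suc_iff) simp
  moreover have "of_nat (Suc j) * (of_nat (Suc j) - 1 + z) ^ N / fact (Suc j)
      = (of_nat j + z) ^ N / fact j" for j
  proof -
    have "of_nat (Suc j) * u / fact (Suc j) = u / fact j" for u :: 'a
      by (simp only: fact_Suc of_nat_mult) (simp del: of_nat_Suc)
    then show ?thesis by simp
  qed
  ultimately show ?thesis by simp
qed

lemma dobinski_shifted: "(\<lambda>j. real (Suc j) ^ N / fact j) sums (exp 1 * real (bell (Suc N)))"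
  using levels_dobinski[of "1::real" N] by (simp add: bell_def add.commute)

lemma bell_0: "bell 0 = 1"
proof -
  have "set_partitions 0 = {{}}"
    by (auto simp: set_partitions_def partition_on_empty)
  then show ?thesis by (simp add: bell_def)
qed

lemma bell_pos: "bell n > 0"
  using finite_set_partitions[of n] set_partitions_nonempty[of n]
  by (simp add: bell_def card_gt_0_iff)

text \<open>The binomial theorem for \<open>((j + 1) + y) ^ N\<close>, followed by Dobinski's formula for each power of
  \<open>j + 1\<close>.\<close>

lemma sum_power_levels_eq_bell:
  fixes y :: real
  shows "(\<Sum>P\<in>set_partitions (Suc N). (1 + y) ^ levels (Suc N) P)
       = (\<Sum>k\<le>N. real (N choose k) * real (bell (Suc (N - k))) * y ^ k)"
proof -
  have "(\<lambda>j. \<Sum>k\<le>N. real (N choose k) * y ^ k * (real (Suc j) ^ (N - k) / fact j))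
    sums (\<Sum>k\<le>N. real (N choose k) * y ^ k * (exp 1 * real (bell (Suc (N - k)))))"
    by (intro sums_sum sums_mult dobinski_shifted)
  moreover have "(\<Sum>k\<le>N. real (N choose k) * y ^ k * (real (Suc j) ^ (N - k) / fact j))
      = (real j + (1 + y)) ^ N / fact j" for j
    by (simp add: binomial_ring[of y "real (Suc j)" N, symmetric] sum_divide_distrib[symmetric]
        add_ac del: of_nat_Suc) (simp add: add_ac)
  ultimately have "(\<Sum>k\<le>N. real (N choose k) * y ^ k * (exp 1 * real (bell (Suc (N - k)))))
     = exp 1 * (\<Sum>P\<in>set_partitions (Suc N). (1 + y) ^ levels (Suc N) P)"
    using levels_dobinski[of "1 + y" N] by (simp add: sums_unique2)
  also have "(\<Sum>k\<le>N. real (N choose k) * y ^ k * (exp 1 * real (bell (Suc (N - k)))))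
     = exp 1 * (\<Sum>k\<le>N. real (N choose k) * real (bell (Suc (N - k))) * y ^ k)"
    by (simp add: sum_distrib_left mult_ac)
  finally show ?thesis by simp
qed

lemma levels_le: "levels (Suc N) P \<le> N"
proof -
  have "levels (Suc N) P \<le> card {1..N}"
    unfolding levels_def by (intro card_mono) auto
  then show ?thesis by simp
qed

text \<open>Comparing the coefficients of \<open>y\<close> in the identity for \<open>(1 + y) ^ L\<close> gives all binomial moments
  at once.\<close>

lemma sum_binomial_levels:
  assumes "k \<le> N"
  shows "(\<Sum>P\<in>set_partitions (Suc N). real (levels (Suc N) P choose k))
       = real (N choose k) * real (bell (Suc (N - k)))"
proof -
  have "\<forall>y::real. (\<Sum>k\<le>N. (\<Sum>P\<in>set_partitions (Suc N). real (levels (Suc N) P choose k)) * y ^ k)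
     = (\<Sum>k\<le>N. real (N choose k) * real (bell (Suc (N - k))) * y ^ k)"
  proof
    fix y :: real
    have "(\<Sum>k\<le>N. (\<Sum>P\<in>set_partitions (Suc N). real (levels (Suc N) P choose k)) * y ^ k)
      = (\<Sum>P\<in>set_partitions (Suc N). \<Sum>k\<le>N. real (levels (Suc N) P choose k) * y ^ k)"
      by (subst sum.swap) (simp add: sum_distrib_right)
    also have "\<dots> = (\<Sum>P\<in>set_partitions (Suc N). (1 + y) ^ levels (Suc N) P)"
    proof (rule sum.cong[OF refl])
      fix P
      have "(\<Sum>k\<le>N. real (levels (Suc N) P choose k) * y ^ k)
        = (\<Sum>k\<le>levels (Suc N) P. real (levels (Suc N) P choose k) * y ^ k)"
        using levels_le[of N P] by (intro sum.mono_neutral_right) auto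
      also have "\<dots> = (1 + y) ^ levels (Suc N) P"
        using binomial_ring[of y 1 "levels (Suc N) P"] by (simp add: add.commute)
      finally show "(\<Sum>k\<le>N. real (levels (Suc N) P choose k) * y ^ k) = (1 + y) ^ levels (Suc N) P" .
    qed
    also note sum_power_levels_eq_bell
    finally show "(\<Sum>k\<le>N. (\<Sum>P\<in>set_partitions (Suc N). real (levels (Suc N) P choose k)) * y ^ k)
     = (\<Sum>k\<le>N. real (N choose k) * real (bell (Suc (N - k))) * y ^ k)" .
  qed
  then show ?thesis using assms unfolding polyfun_eq_coeffs by blast
qed

lemma expectation_uniform_partition:
  fixes h :: "nat set set \<Rightarrow> 'a::{banach,second_countable_topology}"
  shows "measure_pmf.expectation (uniform_partition n) h
     = (1 / real (bell n)) *\<^sub>R (\<Sum>P\<in>set_partitions n. h P)"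
  unfolding uniform_partition_def bell_def
  by (subst integral_measure_pmf[OF finite_set_partitions])
     (auto simp: set_partitions_nonempty finite_set_partitions scaleR_sum_right)

lemma level_mean_Suc:
  "level_mean (Suc N) = real N * real (bell N) / real (bell (Suc N))"
proof (cases "N = 0")
  case True
  then have "levels (Suc N) P = 0" for P using levels_le[of N P] by simp
  then show ?thesis using True by (simp add: level_mean_def)
next
  case False
  then show ?thesis
    using sum_binomial_levels[of 1 N]
    by (simp add: level_mean_def expectation_uniform_partition)
qed

lemma two_times_choose_two: "2 * real (m choose 2) = real m * (real m - 1)"
  by (induction m) (simp_all add: numeral_2_eq_2 algebra_simps)

lemma level_variance_Suc:
  assumes "N \<ge> 1"
  shows "level_variance (Suc N) =
          real N * real (bell N) / real (bell (Suc N))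
          + real N * (real N - 1) * real (bell (N - 1)) / real (bell (Suc N))
          - (real N)\<^sup>2 * (real (bell N))\<^sup>2 / (real (bell (Suc N)))\<^sup>2"
proof -
  let ?n = "Suc N" let ?S = "set_partitions ?n"
  have int: "integrable (measure_pmf (uniform_partition ?n)) h" for h :: "_ \<Rightarrow> real"
    unfolding uniform_partition_def
    by (rule integrable_measure_pmf_finite) (simp add: finite_set_partitions set_partitions_nonempty)
  have "level_variance ?n
     = measure_pmf.expectation (uniform_partition ?n) (\<lambda>P. (real (levels ?n P))\<^sup>2) - (level_mean ?n)\<^sup>2"
    unfolding level_variance_def level_mean_def by (rule measure_pmf.variance_eq) (rule int)+
  also have "measure_pmf.expectation (uniform_partition ?n) (\<lambda>P. (real (levels ?n P))\<^sup>2)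
     = (\<Sum>P\<in>?S. (real (levels ?n P))\<^sup>2) / real (bell ?n)"
    by (simp add: expectation_uniform_partition)
  also have "(\<Sum>P\<in>?S. (real (levels ?n P))\<^sup>2)
     = (\<Sum>P\<in>?S. real (levels ?n P choose 1)) + 2 * (\<Sum>P\<in>?S. real (levels ?n P choose 2))"
    by (simp add: sum_distrib_left sum.distrib[symmetric] two_times_choose_two
        power2_eq_square algebra_simps)
  also have "2 * (\<Sum>P\<in>?S. real (levels ?n P choose 2)) = real N * (real N - 1) * real (bell (N - 1))"
  proof (cases "N = 1")
    case True
    then have "levels ?n P choose 2 = 0" for P using levels_le[of N P] by (intro binomial_eq_0) simp
    then have "(\<Sum>P\<in>?S. real (levels ?n P choose 2)) = 0" by (simp only: of_nat_0 sum.neutral_const)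
    then show ?thesis using True by simp
  next
    case False
    then have "Suc (N - 2) = N - 1" "2 \<le> N" using assms by auto
    then have "2 * (\<Sum>P\<in>?S. real (levels ?n P choose 2))
        = 2 * real (N choose 2) * real (bell (N - 1))"
      using sum_binomial_levels[of 2 N] by simp
    then show ?thesis by (simp only: two_times_choose_two)
  qed
  also have "(\<Sum>P\<in>?S. real (levels ?n P choose 1)) = real N * real (bell N)"
    using sum_binomial_levels[of 1 N] assms by simp
  finally show ?thesis
    by (simp add: level_mean_Suc power_divide power_mult_distrib add_divide_distrib)
qed

section \<open>Inequalities for ratios of consecutive Bell numbers\<close>

definition bell_ratio :: "nat \<Rightarrow> real" where
  "bell_ratio n = real (bell (Suc n)) / real (bell n)"

lemma bell_Suc: "real (bell (Suc n)) = bell_ratio n * real (bell n)"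
  using bell_pos[of n] by (simp add: bell_ratio_def)

lemma bell_ratio_pos: "bell_ratio n > 0"
  using bell_pos by (simp add: bell_ratio_def)

text \<open>Log-convexity of the Bell numbers, which are the moments of the measure with mass
  \<open>1 / (e m!)\<close> at \<open>m\<close>: expand the nonnegative sum of \<open>(m - r)\<^sup>2 m ^ n / m!\<close> for the optimal
  value \<open>r\<close>.\<close>

lemma bell_ratio_mono_Suc: "bell_ratio n \<le> bell_ratio (Suc n)"
proof -
  define r where "r = bell_ratio n"
  have S: "(\<lambda>m. real m ^ Suc (Suc n) / fact m - 2 * r * (real m ^ Suc n / fact m)
       + r\<^sup>2 * (real m ^ n / fact m))
    sums (exp 1 * real (bell (Suc (Suc n))) - 2 * r * (exp 1 * real (bell (Suc n)))
       + r\<^sup>2 * (exp 1 * real (bell n)))"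
    by (intro sums_add sums_diff sums_mult dobinski)
  have eq: "real m ^ Suc (Suc n) / fact m - 2 * r * (real m ^ Suc n / fact m)
       + r\<^sup>2 * (real m ^ n / fact m) = (real m - r)\<^sup>2 * real m ^ n / fact m" for m
    by (simp add: field_simps power2_eq_square)
  have "0 \<le> exp 1 * real (bell (Suc (Suc n))) - 2 * r * (exp 1 * real (bell (Suc n)))
       + r\<^sup>2 * (exp 1 * real (bell n))"
    by (rule sums_le[OF _ sums_zero S]) (unfold eq, simp)
  also have "\<dots> = exp 1 * (r * real (bell n) * (bell_ratio (Suc n) - r))"
    by (simp add: bell_Suc r_def power2_eq_square algebra_simps)
  finally have "0 \<le> exp 1 * (r * real (bell n) * (bell_ratio (Suc n) - r))" .
  moreover have "0 < r * real (bell n)"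
    using bell_ratio_pos[of n] bell_pos[of n] by (simp add: r_def)
  ultimately have "0 \<le> bell_ratio (Suc n) - r"
    by (simp only: zero_le_mult_iff exp_gt_zero) (use exp_gt_zero[of "1::real"] in linarith)
  then show ?thesis by (simp add: r_def)
qed

lemma bell_ratio_mono: "mono bell_ratio"
  by (simp add: incseq_SucI bell_ratio_mono_Suc)

lemma sums_index_times_shifted_powers:
  "(\<lambda>j. real j * real (Suc j) ^ N / fact j)
     sums (exp 1 * (real (bell (Suc (Suc N))) - real (bell (Suc N))))"
proof -
  have "(\<lambda>j. real (Suc j) ^ Suc N / fact j - real (Suc j) ^ N / fact j)
     sums (exp 1 * real (bell (Suc (Suc N))) - exp 1 * real (bell (Suc N)))"
    by (intro sums_diff dobinski_shifted)
  then show ?thesis by (simp add: field_simps)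
qed

text \<open>A shift of the summation index by one: \<open>(j + 2) ^ N / j! = (j + 1) ((j + 1) + 1) ^ N / (j + 1)!\<close>.\<close>

lemma sums_twice_shifted_powers:
  "(\<lambda>j. (real j + 2) ^ N / fact j)
     sums (exp 1 * (real (bell (Suc (Suc N))) - real (bell (Suc N))))"
proof -
  have "(\<lambda>j. real (Suc j) * real (Suc (Suc j)) ^ N / fact (Suc j))
     sums (exp 1 * (real (bell (Suc (Suc N))) - real (bell (Suc N))))"
    by (subst sums_Suc_iff) (use sums_index_times_shifted_powers[of N] in simp)
  moreover have "real (Suc j) * real (Suc (Suc j)) ^ N / fact (Suc j) = (real j + 2) ^ N / fact j" for j
    by (simp add: add.commute del: of_nat_Suc) (simp add: add_ac)
  ultimately show ?thesis by simp
qed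

lemma bell_ratio_gt_1: "bell_ratio (Suc N) > 1"
proof -
  have "0 < exp 1 * (real (bell (Suc (Suc N))) - real (bell (Suc N)))"
  proof -
    have "0 < (\<Sum>j. real j * real (Suc j) ^ N / fact j)"
      by (rule suminf_pos2[OF sums_summable[OF sums_index_times_shifted_powers], where i = 1]) auto
    then show ?thesis using sums_unique[OF sums_index_times_shifted_powers] by simp
  qed
  then show ?thesis using bell_pos[of "Suc N"] by (simp add: bell_ratio_def zero_less_mult_iff)
qed

text \<open>Let \<open>J\<close> have weights \<open>q j\<close> proportional to \<open>(j + 1) ^ N / j!\<close>, so that \<open>c = E(J) + 1\<close>.  The
  quotient \<open>g j = (j + 1) q (j + 1) / q j = ((j + 2) / (j + 1)) ^ N\<close> decreases in \<open>j\<close>, so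
  Chebyshev's inequality gives \<open>E(J\<^sup>2) = E((J + 1) g J) \<le> E(J + 1) E(g J) = c E(J)\<close>, that is,
  the variance of \<open>J\<close> is at most its mean.  In terms of Bell numbers this is the claim.  Since
  \<open>\<kappa> = g (c - 1)\<close> is the value of \<open>g\<close> at the mean, \<open>(j + 1 - c) (g j - \<kappa>) \<le> 0\<close> for every
  single \<open>j\<close>, and no double sum is needed.\<close>

lemma bell_ratio_step: "bell_ratio (Suc (Suc N)) \<le> bell_ratio (Suc N) + 1"
proof -
  define c where "c = bell_ratio (Suc N)"
  define b where "b = real (bell (Suc N))"
  define \<kappa> where "\<kappa> = ((c + 1) / c) ^ N"
  have c: "c > 1" and b: "b > 0" using bell_ratio_gt_1 bell_pos by (auto simp: c_def b_def)
  have B: "real (bell (Suc (Suc N))) = c * b"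
    "real (bell (Suc (Suc (Suc N)))) = bell_ratio (Suc (Suc N)) * (c * b)"
    by (simp_all add: bell_Suc c_def b_def)
  have g: "(\<lambda>j. (real j + 2) ^ N / fact j) sums (exp 1 * (c * b - b))"
    using sums_twice_shifted_powers[of N] by (simp add: B b_def)
  have jg: "(\<lambda>j. (real j + 2) ^ Suc N / fact j)
       sums (exp 1 * (bell_ratio (Suc (Suc N)) * (c * b) - c * b))"
    using sums_twice_shifted_powers[of "Suc N"] by (simp only: B)
  have S: "(\<lambda>j. (real j + 2) ^ Suc N / fact j - (1 + c) * ((real j + 2) ^ N / fact j)
        - \<kappa> * (real (Suc j) ^ Suc N / fact j - c * (real (Suc j) ^ N / fact j)))
     sums (exp 1 * (bell_ratio (Suc (Suc N)) * (c * b) - c * b) - (1 + c) * (exp 1 * (c * b - b))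
        - \<kappa> * (exp 1 * real (bell (Suc (Suc N))) - c * (exp 1 * real (bell (Suc N)))))"
    by (intro sums_diff sums_mult dobinski_shifted g jg)
  have le: "(real j + 2) ^ Suc N / fact j - (1 + c) * ((real j + 2) ^ N / fact j)
        - \<kappa> * (real (Suc j) ^ Suc N / fact j - c * (real (Suc j) ^ N / fact j)) \<le> 0" for j
  proof -
    define x where "x = real (Suc j)"
    have x: "x > 0" "real j + 2 = x + 1" by (simp_all add: x_def)
    have "(x - c) * ((x + 1) ^ N - \<kappa> * x ^ N) \<le> 0"
    proof (cases "x \<le> c")
      case True
      have "(c + 1) / c \<le> (x + 1) / x" using True x(1) c by (simp add: field_simps)
      then have "\<kappa> \<le> ((x + 1) / x) ^ N" unfolding \<kappa>_def using c by (intro power_mono) auto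
      then have "\<kappa> * x ^ N \<le> (x + 1) ^ N" using x(1) by (simp add: power_divide field_simps)
      then show ?thesis using True by (intro mult_nonpos_nonneg) auto
    next
      case False
      have "(x + 1) / x \<le> (c + 1) / c" using False x(1) c by (simp add: field_simps)
      then have "((x + 1) / x) ^ N \<le> \<kappa>" unfolding \<kappa>_def using x(1) by (intro power_mono) auto
      then have "(x + 1) ^ N \<le> \<kappa> * x ^ N" using x(1) by (simp add: power_divide field_simps)
      then show ?thesis using False by (intro mult_nonneg_nonpos) auto
    qed
    then have "(x - c) * ((x + 1) ^ N - \<kappa> * x ^ N) / fact j \<le> 0"
      by (simp add: divide_le_0_iff)
    also have "(x - c) * ((x + 1) ^ N - \<kappa> * x ^ N) / fact j
      = (real j + 2) ^ Suc N / fact j - (1 + c) * ((real j + 2) ^ N / fact j)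
        - \<kappa> * (real (Suc j) ^ Suc N / fact j - c * (real (Suc j) ^ N / fact j))"
      unfolding x(2) x_def[symmetric] by (simp add: field_simps)
    finally show ?thesis .
  qed
  have "exp 1 * (bell_ratio (Suc (Suc N)) * (c * b) - c * b) - (1 + c) * (exp 1 * (c * b - b))
        - \<kappa> * (exp 1 * real (bell (Suc (Suc N))) - c * (exp 1 * real (bell (Suc N)))) \<le> 0"
    by (rule sums_le[OF le S sums_zero])
  also have "exp 1 * (bell_ratio (Suc (Suc N)) * (c * b) - c * b) - (1 + c) * (exp 1 * (c * b - b))
        - \<kappa> * (exp 1 * real (bell (Suc (Suc N))) - c * (exp 1 * real (bell (Suc N))))
     = exp 1 * (b * (c * (bell_ratio (Suc (Suc N)) - (c + 1)) + 1))"
    unfolding B by (simp add: b_def[symmetric] algebra_simps)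
  finally have "c * (bell_ratio (Suc (Suc N)) - (c + 1)) \<le> -1"
    using b by (simp add: mult_le_0_iff)
  then have "c * (bell_ratio (Suc (Suc N)) - (c + 1)) < 0" by linarith
  then show ?thesis using c by (simp add: mult_less_0_iff c_def)
qed

text \<open>Bernoulli's inequality, as the tangent line of the convex function \<open>u ^ n\<close> at \<open>c\<close>.\<close>

lemma power_ge_tangent:
  fixes u c :: real
  assumes "u \<ge> 0" "c > 0"
  shows "u ^ n \<ge> c ^ n + real n * c ^ (n - 1) * (u - c)"
proof (cases n)
  case (Suc m)
  have "1 + real n * (u / c - 1) \<le> (1 + (u / c - 1)) ^ n"
    using assms by (intro Bernoulli_inequality) simp
  then have "c ^ n * (1 + real n * (u / c - 1)) \<le> c ^ n * (u / c) ^ n"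
    using assms by (intro mult_left_mono) auto
  also have "c ^ n * (u / c) ^ n = u ^ n" using assms by (simp add: power_divide)
  also have "c ^ n * (1 + real n * (u / c - 1)) = c ^ n + real n * (c ^ n * (u / c - 1))"
    by (simp add: algebra_simps)
  also have "c ^ n * (u / c - 1) = c ^ (n - 1) * (u - c)"
    using assms by (simp add: Suc field_simps)
  finally show ?thesis by (simp add: mult.assoc)
qed simp

text \<open>With \<open>J\<close> as in \<open>bell_ratio_step\<close>, \<open>a N\<close> is the mean of \<open>J\<close>, and
  \<open>E(J (J / (J + 1)) ^ N) = 1\<close>, because this expectation is the quotient of two equal sums.  The
  function \<open>x (x / (x + 1)) ^ N\<close> is convex, so Jensen's inequality bounds its value at the mean by 1.
  Its tangent at the mean comes from the tangent of \<open>u ^ (N + 1)\<close> at \<open>c = a / (a + 1)\<close>, taken at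
  \<open>u = j / (j + 1)\<close> and multiplied by \<open>j + 1\<close>.\<close>

lemma bell_ratio_upper:
  defines "a \<equiv> \<lambda>N. bell_ratio (Suc N) - 1"
  shows "a N * (a N / (a N + 1)) ^ N \<le> 1"
proof -
  define x where "x = a N"
  define c where "c = x / (x + 1)"
  define b where "b = real (bell (Suc N))"
  have x: "x > 0" and b: "b > 0" using bell_ratio_gt_1 bell_pos by (auto simp: x_def a_def b_def)
  have c: "c > 0" "c * (x + 1) = x" using x by (auto simp: c_def)
  have B: "real (bell (Suc (Suc N))) = (x + 1) * b"
    by (simp add: bell_Suc x_def a_def b_def)
  have S: "(\<lambda>j. (real (Suc N) * c ^ N) * (real j * real (Suc j) ^ N / fact j)
        - (real N * c ^ Suc N) * (real (Suc j) ^ Suc N / fact j))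
     sums ((real (Suc N) * c ^ N) * (exp 1 * (real (bell (Suc (Suc N))) - real (bell (Suc N))))
        - (real N * c ^ Suc N) * (exp 1 * real (bell (Suc (Suc N)))))"
    by (intro sums_diff sums_mult dobinski_shifted sums_index_times_shifted_powers)
  have le: "(real (Suc N) * c ^ N) * (real j * real (Suc j) ^ N / fact j)
        - (real N * c ^ Suc N) * (real (Suc j) ^ Suc N / fact j) \<le> real j ^ Suc N / fact j" for j
  proof -
    define y where "y = real (Suc j)"
    have y: "y > 0" by (simp add: y_def)
    have "c ^ Suc N + real (Suc N) * c ^ N * (real j / y - c) \<le> (real j / y) ^ Suc N"
      using power_ge_tangent[of "real j / y" c "Suc N"] c y by simp
    then have "(c ^ Suc N + real (Suc N) * c ^ N * (real j / y - c)) * y ^ Suc N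
        \<le> (real j / y) ^ Suc N * y ^ Suc N"
      using y by (intro mult_right_mono) auto
    also have "(real j / y) ^ Suc N * y ^ Suc N = real j ^ Suc N"
      using y by (simp add: power_divide)
    also have "(c ^ Suc N + real (Suc N) * c ^ N * (real j / y - c)) * y ^ Suc N
       = real (Suc N) * c ^ N * (real j * y ^ N) - real N * c ^ Suc N * y ^ Suc N"
      using y by (simp add: field_simps)
    finally have "(real (Suc N) * c ^ N * (real j * y ^ N) - real N * c ^ Suc N * y ^ Suc N) / fact j
        \<le> real j ^ Suc N / fact j"
      by (intro divide_right_mono) auto
    then show ?thesis
      unfolding y_def[symmetric] by (simp only: diff_divide_distrib times_divide_eq_right mult.assoc)
  qed
  have "(real (Suc N) * c ^ N) * (exp 1 * (real (bell (Suc (Suc N))) - real (bell (Suc N))))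
        - (real N * c ^ Suc N) * (exp 1 * real (bell (Suc (Suc N)))) \<le> exp 1 * b"
    unfolding b_def by (rule sums_le[OF le S dobinski])
  also have "(real (Suc N) * c ^ N) * (exp 1 * (real (bell (Suc (Suc N))) - real (bell (Suc N))))
        - (real N * c ^ Suc N) * (exp 1 * real (bell (Suc (Suc N))))
     = exp 1 * b * (c ^ N * (real (Suc N) * x - real N * (c * (x + 1))))"
    unfolding B by (simp add: b_def[symmetric] algebra_simps)
  finally show ?thesis using b unfolding c(2) by (simp add: x_def[symmetric] c_def algebra_simps)
qed

lemma bell_Suc_0: "bell (Suc 0) = 1"
proof -
  have "(\<lambda>j. real (Suc j) ^ 0 / fact j) sums (exp 1 * real (bell 0))"
    using dobinski[of 0] by simp
  from sums_unique2[OF dobinski_shifted[of 0] this] show ?thesis by (simp add: bell_0)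
qed

text \<open>With \<open>J\<close> as in \<open>bell_ratio_step\<close>, the mean of \<open>J\<close> equals \<open>E((1 + 1 / (J + 1)) ^ N)\<close>, which by
  Jensen's inequality is at least \<open>(1 + E(1 / (J + 1))) ^ N\<close>; and
  \<open>E(1 / (J + 1)) = B N / B (N + 1)\<close> for \<open>N \<ge> 1\<close>.\<close>

lemma bell_ratio_lower: "(1 + 1 / bell_ratio N) ^ N \<le> bell_ratio (Suc N) - 1"
proof (cases N)
  case 0
  have "(\<lambda>j. (real j + 2) ^ 0 / fact j) sums (exp 1 * real (bell 0))"
    using dobinski[of 0] by simp
  from sums_unique2[OF sums_twice_shifted_powers this]
  show ?thesis by (simp add: 0 bell_ratio_def bell_Suc_0 bell_0)
next
  case (Suc M)
  define r where "r = bell_ratio N"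
  define c where "c = 1 + 1 / r"
  define b where "b = real (bell N)"
  have r: "r > 0" and b: "b > 0" using bell_ratio_pos bell_pos by (auto simp: r_def b_def)
  have c: "c > 0" using r by (simp add: c_def add_pos_pos)
  have B: "real (bell (Suc N)) = r * b" "real (bell (Suc (Suc N))) = bell_ratio (Suc N) * (r * b)"
    by (simp_all add: bell_Suc r_def b_def)
  have S: "(\<lambda>j. c ^ N * (real (Suc j) ^ N / fact j)
        + real N * c ^ M * (real (Suc j) ^ M / fact j - real (Suc j) ^ N / fact j / r))
     sums (c ^ N * (exp 1 * real (bell (Suc N)))
        + real N * c ^ M * (exp 1 * real (bell (Suc M)) - exp 1 * real (bell (Suc N)) / r))"
    by (intro sums_add sums_diff sums_divide sums_mult dobinski_shifted)
  have le: "c ^ N * (real (Suc j) ^ N / fact j)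
        + real N * c ^ M * (real (Suc j) ^ M / fact j - real (Suc j) ^ N / fact j / r)
      \<le> (real j + 2) ^ N / fact j" for j
  proof -
    define y where "y = real (Suc j)"
    have y: "y > 0" "real j + 2 = y + 1" by (simp_all add: y_def)
    have "c ^ N + real N * c ^ M * ((y + 1) / y - c) \<le> ((y + 1) / y) ^ N"
      using power_ge_tangent[of "(y + 1) / y" c N] c y by (simp add: Suc)
    then have "(c ^ N + real N * c ^ M * ((y + 1) / y - c)) * y ^ N \<le> ((y + 1) / y) ^ N * y ^ N"
      using y by (intro mult_right_mono) auto
    also have "((y + 1) / y) ^ N * y ^ N = (y + 1) ^ N"
      using y by (simp add: power_divide)
    also have "(c ^ N + real N * c ^ M * ((y + 1) / y - c)) * y ^ N
       = c ^ N * y ^ N + real N * c ^ M * (y ^ M - y ^ N / r)"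
    proof -
      have "((y + 1) / y - c) * y ^ N = y ^ M - y ^ N / r"
        using y r by (simp add: Suc c_def field_simps)
      then show ?thesis by (simp only: distrib_right mult.assoc)
    qed
    finally have "(c ^ N * y ^ N + real N * c ^ M * (y ^ M - y ^ N / r)) / fact j \<le> (y + 1) ^ N / fact j"
      by (intro divide_right_mono) auto
    then show ?thesis
      unfolding y(2) y_def[symmetric]
      by (simp add: add_divide_distrib diff_divide_distrib right_diff_distrib mult_ac)
  qed
  have "c ^ N * (exp 1 * real (bell (Suc N)))
        + real N * c ^ M * (exp 1 * real (bell (Suc M)) - exp 1 * real (bell (Suc N)) / r)
      \<le> exp 1 * (real (bell (Suc (Suc N))) - real (bell (Suc N)))"
    by (rule sums_le[OF le S sums_twice_shifted_powers])
  also have "exp 1 * real (bell (Suc M)) - exp 1 * real (bell (Suc N)) / r = 0"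
    using r by (simp add: B Suc[symmetric] b_def)
  finally have "exp 1 * (r * b) * c ^ N \<le> exp 1 * (r * b) * (bell_ratio (Suc N) - 1)"
    unfolding B by (simp add: algebra_simps)
  then show ?thesis using r b by (simp add: c_def r_def)
qed

section \<open>Asymptotics of mean and variance\<close>

text \<open>Logarithms of the two Jensen bounds, using \<open>1 / (y + 1) \<le> ln (1 + 1 / y)\<close> and
  \<open>ln (1 + 1 / a) \<le> 1 / a\<close>.\<close>

lemma bell_ratio_log_bounds:
  defines "y \<equiv> \<lambda>N. bell_ratio (Suc N)"
  shows "(y N - 1) * ln (y N - 1) \<le> real N" "real N \<le> (y N + 1) * ln (y N - 1)"
proof -
  define a where "a = y N - 1"
  have a: "a > 0" using bell_ratio_gt_1[of N] by (simp add: a_def y_def)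
  have "ln (a * (a / (a + 1)) ^ N) \<le> 0"
    using bell_ratio_upper[of N] a by (simp add: a_def y_def)
  then have "ln a \<le> real N * (ln (a + 1) - ln a)"
    using a by (simp add: ln_mult ln_realpow ln_div algebra_simps)
  also have "ln (a + 1) - ln a = ln (1 + 1 / a)"
    using a ln_div[of "a + 1" a] by (simp add: add_divide_distrib)
  also have "\<dots> \<le> 1 / a" using a by (intro ln_add_one_self_le_self) simp
  finally have "ln a \<le> real N * (1 / a)" by (simp add: mult_left_mono)
  then show "(y N - 1) * ln (y N - 1) \<le> real N" using a by (simp add: a_def field_simps)

  have y: "y N > 0" using bell_ratio_pos by (simp add: y_def)
  have "1 / bell_ratio (Suc N) \<le> 1 / bell_ratio N"
    using bell_ratio_pos bell_ratio_mono_Suc by (intro divide_left_mono) auto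
  then have "(1 + 1 / y N) ^ N \<le> (1 + 1 / bell_ratio N) ^ N"
    using y by (intro power_mono) (auto simp: y_def)
  then have "(1 + 1 / y N) ^ N \<le> a"
    using bell_ratio_lower[of N] by (simp add: a_def y_def)
  then have "ln ((1 + 1 / y N) ^ N) \<le> ln a"
    using y by (intro ln_mono) (auto simp: add_pos_pos)
  then have "real N * ln (1 + 1 / y N) \<le> ln a"
    using y by (simp add: ln_realpow add_pos_pos)
  moreover have "1 / (y N + 1) \<le> ln (1 + 1 / y N)"
  proof -
    have "ln (1 + - (1 / (y N + 1))) \<le> - (1 / (y N + 1))"
      using y by (intro ln_add_one_self_le_self2) (simp add: field_simps)
    also have "1 + - (1 / (y N + 1)) = inverse (1 + 1 / y N)"
      using y by (simp add: field_simps)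
    finally show ?thesis using y by (simp add: ln_inverse add_pos_pos)
  qed
  ultimately have "real N * (1 / (y N + 1)) \<le> ln a"
    by (meson mult_left_mono of_nat_0_le_iff order_trans)
  then show "real N \<le> (y N + 1) * ln (y N - 1)"
    using y by (simp add: a_def field_simps)
qed

text \<open>A crude polynomial lower bound, which beats every power of the logarithm in the error terms.\<close>

lemma bell_ratio_ge_sqrt: "sqrt (real N) - 1 \<le> bell_ratio (Suc N)"
proof -
  define y where "y = bell_ratio (Suc N)"
  have y: "y > 1" using bell_ratio_gt_1 by (simp add: y_def)
  have "ln (y - 1) \<le> y - 1 - 1" using y by (intro ln_le_minus_one) simp
  then have "(y + 1) * ln (y - 1) \<le> (y + 1) * (y + 1)" using y by (intro mult_left_mono) auto
  then have "real N \<le> (y + 1)\<^sup>2"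
    using bell_ratio_log_bounds(2)[of N] by (simp add: y_def power2_eq_square)
  then have "sqrt (real N) \<le> y + 1" using y by (intro real_le_lsqrt) auto
  then show ?thesis by (simp add: y_def)
qed

lemma bell_ratio_at_top: "filterlim (\<lambda>N. bell_ratio (Suc N)) at_top sequentially"
  by (rule filterlim_at_top_mono[where f = "\<lambda>N. sqrt (real N) - 1"])
     (real_asymp, simp add: bell_ratio_ge_sqrt)

text \<open>The logarithmic bounds give \<open>N \<sim> y ln y\<close>; taking logarithms again, \<open>ln N \<sim> ln y\<close>, and so
  \<open>N / y \<sim> ln N\<close>.\<close>

lemma index_over_bell_ratio_asymp:
  "(\<lambda>N. real N / bell_ratio (Suc N) / ln (real N)) \<longlonglongrightarrow> 1"
proof -
  define y where "y = (\<lambda>N. bell_ratio (Suc N))"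
  note y_top = bell_ratio_at_top[folded y_def]
  have big: "eventually (\<lambda>N. y N > 3) sequentially"
    using y_top by (simp add: filterlim_at_top_dense)
  define q where "q = (\<lambda>N. real N / (y N * ln (y N)))"
  have q: "q \<longlonglongrightarrow> 1"
  proof (rule tendsto_sandwich)
    show "\<forall>\<^sub>F N in sequentially. (y N - 1) * ln (y N - 1) / (y N * ln (y N)) \<le> q N"
      using big by eventually_elim
        (use bell_ratio_log_bounds(1) in \<open>auto simp: q_def y_def intro!: divide_right_mono\<close>)
    show "\<forall>\<^sub>F N in sequentially. q N \<le> (y N + 1) * ln (y N - 1) / (y N * ln (y N))"
      using big by eventually_elim
        (use bell_ratio_log_bounds(2) in \<open>auto simp: q_def y_def intro!: divide_right_mono\<close>)
    have "((\<lambda>x::real. (x - 1) * ln (x - 1) / (x * ln x)) \<longlongrightarrow> 1) at_top" by real_asymp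
    from filterlim_compose[OF this y_top]
    show "(\<lambda>N. (y N - 1) * ln (y N - 1) / (y N * ln (y N))) \<longlonglongrightarrow> 1" .
    have "((\<lambda>x::real. (x + 1) * ln (x - 1) / (x * ln x)) \<longlongrightarrow> 1) at_top" by real_asymp
    from filterlim_compose[OF this y_top]
    show "(\<lambda>N. (y N + 1) * ln (y N - 1) / (y N * ln (y N))) \<longlonglongrightarrow> 1" .
  qed
  have "(\<lambda>N. ln (q N) / ln (y N) + (1 + ln (ln (y N)) / ln (y N))) \<longlonglongrightarrow> 0 + 1"
  proof (rule tendsto_add)
    have "(\<lambda>N. ln (q N)) \<longlonglongrightarrow> ln 1" by (intro tendsto_ln q) simp
    moreover have "filterlim (\<lambda>N. ln (y N)) at_top sequentially"
      by (rule filterlim_compose[OF ln_at_top y_top])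
    ultimately show "(\<lambda>N. ln (q N) / ln (y N)) \<longlonglongrightarrow> 0"
      by (intro real_tendsto_divide_at_top)
    have "((\<lambda>x::real. 1 + ln (ln x) / ln x) \<longlongrightarrow> 1) at_top" by real_asymp
    from filterlim_compose[OF this y_top]
    show "(\<lambda>N. 1 + ln (ln (y N)) / ln (y N)) \<longlonglongrightarrow> 1" .
  qed
  moreover have "\<forall>\<^sub>F N in sequentially.
      ln (q N) / ln (y N) + (1 + ln (ln (y N)) / ln (y N)) = ln (real N) / ln (y N)"
    using big eventually_gt_at_top[of 0]
  proof eventually_elim
    case (elim N)
    then have pos: "ln (y N) > 0" by simp
    have "ln (q N) = ln (real N) - (ln (y N) + ln (ln (y N)))"
      using elim pos by (simp add: q_def ln_div ln_mult)
    then show ?case using pos by (simp add: field_simps)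
  qed
  ultimately have lnN: "(\<lambda>N. ln (real N) / ln (y N)) \<longlonglongrightarrow> 1"
    by (simp add: tendsto_cong)
  have "(\<lambda>N. q N / (ln (real N) / ln (y N))) \<longlonglongrightarrow> 1 / 1"
    by (intro tendsto_divide q lnN) simp
  moreover have "\<forall>\<^sub>F N in sequentially. q N / (ln (real N) / ln (y N)) = real N / y N / ln (real N)"
    using big by eventually_elim (simp add: q_def field_simps)
  ultimately show ?thesis by (simp add: y_def tendsto_cong)
qed

lemma level_mean_eq_bell_ratio: "level_mean (Suc N) = real N / bell_ratio N"
  by (simp add: level_mean_Suc bell_ratio_def)

lemma level_mean_over_ln: "(\<lambda>n. level_mean n / ln (real n)) \<longlonglongrightarrow> 1"
proof (rule LIMSEQ_offset[where k = 2])
  have "(\<lambda>m. (real m / bell_ratio (Suc m) / ln (real m))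
       * ((real m + 1) / real m * (ln (real m) / ln (real m + 2)))) \<longlonglongrightarrow> 1 * 1"
    by (intro tendsto_mult index_over_bell_ratio_asymp) real_asymp
  moreover have "\<forall>\<^sub>F m in sequentially. (real m / bell_ratio (Suc m) / ln (real m))
       * ((real m + 1) / real m * (ln (real m) / ln (real m + 2)))
       = level_mean (m + 2) / ln (real (m + 2))"
    using eventually_gt_at_top[of 1]
  proof eventually_elim
    case (elim m)
    then have "ln (real m) > 0" by simp
    moreover have "level_mean (m + 2) = (real m + 1) / bell_ratio (Suc m)"
      using level_mean_eq_bell_ratio[of "Suc m"] by (simp add: add.commute)
    ultimately show ?case using elim by simp
  qed
  ultimately show "(\<lambda>m. level_mean (m + 2) / ln (real (m + 2))) \<longlonglongrightarrow> 1"
    by (simp add: tendsto_cong)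
qed

text \<open>The variance of \<open>N / M\<close>, where \<open>M\<close> has weights proportional to \<open>m ^ (N + 1) / m!\<close>,
  provided that \<open>N \<ge> 2\<close>.\<close>

definition rate_variance :: "nat \<Rightarrow> real" where
  "rate_variance N = (real N)\<^sup>2 *
     (real (bell (N - 1)) / real (bell (Suc N)) - (real (bell N) / real (bell (Suc N)))\<^sup>2)"

lemma bell_quotient_two_steps:
  "real (bell N) / real (bell (Suc (Suc N))) = 1 / (bell_ratio (Suc N) * bell_ratio N)"
  using bell_pos by (simp add: bell_ratio_def)

text \<open>The difference of two consecutive ratios lies between 0 and 1, and it is the only
  factor of the variance that is not explicit.\<close>

lemma rate_variance_bounds:
  assumes "N \<ge> 2"
  shows "0 \<le> rate_variance N" "rate_variance N \<le> (level_mean (Suc N))\<^sup>2 / bell_ratio (N - 1)"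
proof -
  obtain M where N: "N = Suc (Suc M)" using le_Suc_ex[OF assms] by auto
  define r s where "r = bell_ratio (Suc M)" and "s = bell_ratio (Suc (Suc M))"
  have rs: "r > 0" "s > 0" "r \<le> s" "s \<le> r + 1"
    using bell_ratio_pos bell_ratio_mono_Suc bell_ratio_step by (auto simp: r_def s_def)
  have b: "real (bell N) / real (bell (Suc N)) = 1 / s"
    by (simp add: N s_def bell_ratio_def)
  have "rate_variance N = (real N)\<^sup>2 * (1 / (s * r) - (1 / s)\<^sup>2)"
    unfolding rate_variance_def b unfolding N diff_Suc_1 bell_quotient_two_steps
    by (simp add: r_def s_def)
  also have "\<dots> = (real N / s)\<^sup>2 / r * (s - r)"
    using rs by (simp add: field_simps power2_eq_square)
  finally have V: "rate_variance N = (real N / s)\<^sup>2 / r * (s - r)" .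
  show "0 \<le> rate_variance N" unfolding V using rs by (intro mult_nonneg_nonneg) auto
  have "rate_variance N \<le> (real N / s)\<^sup>2 / r * 1"
    unfolding V using rs by (intro mult_left_mono) auto
  then show "rate_variance N \<le> (level_mean (Suc N))\<^sup>2 / bell_ratio (N - 1)"
    by (simp add: level_mean_eq_bell_ratio N r_def s_def)
qed

text \<open>For \<open>N \<ge> 2\<close> this is the law of total variance for the mixture of binomial distributions with
  parameters \<open>N\<close> and \<open>1 / M\<close>: the last term is \<open>N E(1 / M\<^sup>2)\<close>, by which the mean of the conditional variance
  \<open>(N / M) (1 - 1 / M)\<close> falls short of \<open>\<mu>\<close>.\<close>

lemma level_variance_decomposition:
  assumes "N \<ge> 1"
  shows "level_variance (Suc N)
     = level_mean (Suc N) + rate_variance N - level_mean (Suc N) / bell_ratio (N - 1)"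
proof -
  obtain M where N: "N = Suc M" using assms by (metis Suc_le_D One_nat_def)
  have "level_mean (Suc N) / bell_ratio (N - 1) = real N * real (bell (N - 1)) / real (bell (Suc N))"
    unfolding level_mean_eq_bell_ratio N diff_Suc_1
    using arg_cong[OF bell_quotient_two_steps[of M], of "\<lambda>x. real (Suc M) * x"]
    by (simp add: mult.commute del: of_nat_Suc)
  then show ?thesis
    unfolding level_variance_Suc[OF assms] rate_variance_def level_mean_Suc
    by (simp add: algebra_simps power2_eq_square diff_divide_distrib)
qed

text \<open>The mean grows logarithmically, the ratio of Bell numbers at least like a square root.  This
  quantity dominates all the error terms of the variance.\<close>

lemma level_mean_sq_over_bell_ratio:
  "(\<lambda>N. (level_mean (Suc N))\<^sup>2 / bell_ratio (N - 1)) \<longlonglongrightarrow> 0"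
proof (rule LIMSEQ_offset[where k = 2])
  have "(\<lambda>m. (ln (real (m + 3)))\<^sup>2 / bell_ratio (Suc m)) \<longlonglongrightarrow> 0"
  proof (rule tendsto_sandwich[OF _ _ tendsto_const])
    show "\<forall>\<^sub>F m in sequentially. 0 \<le> (ln (real (m + 3)))\<^sup>2 / bell_ratio (Suc m)"
      using bell_ratio_pos by (intro always_eventually) (auto intro!: divide_nonneg_pos)
    show "\<forall>\<^sub>F m in sequentially. (ln (real (m + 3)))\<^sup>2 / bell_ratio (Suc m)
        \<le> (ln (real (m + 3)))\<^sup>2 / (sqrt (real m) - 1)"
      using eventually_gt_at_top[of 1]
    proof eventually_elim
      case (elim m)
      then have "sqrt (real m) - 1 > 0" by simp
      then show ?case using bell_ratio_ge_sqrt[of m] bell_ratio_pos[of "Suc m"]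
        by (intro divide_left_mono) auto
    qed
    show "(\<lambda>m. (ln (real (m + 3)))\<^sup>2 / (sqrt (real m) - 1)) \<longlonglongrightarrow> 0" by real_asymp
  qed
  moreover have "(\<lambda>m. (level_mean (m + 3) / ln (real (m + 3)))\<^sup>2) \<longlonglongrightarrow> 1\<^sup>2"
    by (intro tendsto_power LIMSEQ_ignore_initial_segment level_mean_over_ln)
  ultimately have "(\<lambda>m. (level_mean (m + 3) / ln (real (m + 3)))\<^sup>2 *
       ((ln (real (m + 3)))\<^sup>2 / bell_ratio (Suc m))) \<longlonglongrightarrow> 1\<^sup>2 * 0"
    by (intro tendsto_mult)
  moreover have "(level_mean (m + 3) / ln (real (m + 3)))\<^sup>2 *
       ((ln (real (m + 3)))\<^sup>2 / bell_ratio (Suc m))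
     = (level_mean (Suc (m + 2)))\<^sup>2 / bell_ratio (m + 2 - 1)" for m
  proof -
    have "ln (real (m + 3)) > 0" by (intro ln_gt_zero) simp
    then show ?thesis by (simp add: power_divide eval_nat_numeral)
  qed
  ultimately show "(\<lambda>m. (level_mean (Suc (m + 2)))\<^sup>2 / bell_ratio (m + 2 - 1)) \<longlonglongrightarrow> 0"
    by (simp only: mult_zero_right)
qed

lemma level_mean_at_top: "filterlim (\<lambda>N. level_mean (Suc N)) at_top sequentially"
proof -
  have "filterlim (\<lambda>n. level_mean n / ln (real n) * ln (real n)) at_top sequentially"
    by (rule filterlim_tendsto_pos_mult_at_top[OF level_mean_over_ln]) (simp, real_asymp)
  moreover have "\<forall>\<^sub>F n in sequentially. level_mean n / ln (real n) * ln (real n) = level_mean n"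
    using eventually_gt_at_top[of 1] by eventually_elim simp
  ultimately have "filterlim level_mean at_top sequentially"
    by (rule filterlim_cong[OF refl refl, THEN iffD1, rotated])
  then show ?thesis by (rule filterlim_compose) (rule filterlim_Suc)
qed

lemma rate_variance_tendsto: "rate_variance \<longlonglongrightarrow> 0"
proof (rule tendsto_sandwich[OF _ _ tendsto_const level_mean_sq_over_bell_ratio])
  show "\<forall>\<^sub>F N in sequentially. 0 \<le> rate_variance N"
    using eventually_ge_at_top[of 2] by eventually_elim (rule rate_variance_bounds(1))
  show "\<forall>\<^sub>F N in sequentially.
      rate_variance N \<le> (level_mean (Suc N))\<^sup>2 / bell_ratio (N - 1)"
    using eventually_ge_at_top[of 2] by eventually_elim (rule rate_variance_bounds(2))
qed

lemma level_variance_over_mean: "(\<lambda>N. level_variance (Suc N) / level_mean (Suc N)) \<longlonglongrightarrow> 1"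
proof -
  have inv: "(\<lambda>N. 1 / level_mean (Suc N)) \<longlonglongrightarrow> 0"
    by (rule real_tendsto_divide_at_top[OF tendsto_const level_mean_at_top])
  have "(\<lambda>N. 1 + rate_variance N * (1 / level_mean (Suc N))
      - (level_mean (Suc N))\<^sup>2 / bell_ratio (N - 1) * (1 / level_mean (Suc N)) * (1 / level_mean (Suc N)))
      \<longlonglongrightarrow> 1 + 0 * 0 - 0 * 0 * 0"
    by (intro tendsto_add tendsto_diff tendsto_mult tendsto_const inv rate_variance_tendsto
        level_mean_sq_over_bell_ratio)
  moreover have "\<forall>\<^sub>F N in sequentially. 1 + rate_variance N * (1 / level_mean (Suc N))
      - (level_mean (Suc N))\<^sup>2 / bell_ratio (N - 1) * (1 / level_mean (Suc N)) * (1 / level_mean (Suc N))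
      = level_variance (Suc N) / level_mean (Suc N)"
    using eventually_ge_at_top[of 1]
      eventually_compose_filterlim[OF eventually_gt_at_top[of "0::real"] level_mean_at_top]
  proof eventually_elim
    case (elim N)
    then show ?case
      using bell_ratio_pos[of "N - 1"]
      by (simp add: level_variance_decomposition field_simps power2_eq_square)
  qed
  ultimately show ?thesis by (simp add: tendsto_cong)
qed

lemma level_variance_over_ln: "(\<lambda>n. level_variance n / ln (real n)) \<longlonglongrightarrow> 1"
proof (rule LIMSEQ_offset[where k = 1])
  have "(\<lambda>N. level_variance (Suc N) / level_mean (Suc N) * (level_mean (Suc N) / ln (real (Suc N))))
      \<longlonglongrightarrow> 1 * 1"
    by (intro tendsto_mult level_variance_over_mean filterlim_compose[OF level_mean_over_ln filterlim_Suc])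
  moreover have "\<forall>\<^sub>F N in sequentially.
      level_variance (Suc N) / level_mean (Suc N) * (level_mean (Suc N) / ln (real (Suc N)))
      = level_variance (Suc N) / ln (real (Suc N))"
    using eventually_compose_filterlim[OF eventually_gt_at_top[of "0::real"] level_mean_at_top]
    by eventually_elim simp
  ultimately show "(\<lambda>N. level_variance (N + 1) / ln (real (N + 1))) \<longlonglongrightarrow> 1"
    unfolding mult_1 Suc_eq_plus1 by (rule Lim_transform_eventually)
qed

lemma level_variance_at_top: "filterlim (\<lambda>N. level_variance (Suc N)) at_top sequentially"
proof -
  have "filterlim (\<lambda>N. level_variance (Suc N) / level_mean (Suc N) * level_mean (Suc N)) at_top sequentially"
    by (rule filterlim_tendsto_pos_mult_at_top[OF level_variance_over_mean _ level_mean_at_top]) simp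
  moreover have "\<forall>\<^sub>F N in sequentially.
      level_variance (Suc N) / level_mean (Suc N) * level_mean (Suc N) = level_variance (Suc N)"
    using eventually_compose_filterlim[OF eventually_gt_at_top[of "0::real"] level_mean_at_top]
    by eventually_elim simp
  ultimately show ?thesis
    by (rule filterlim_cong[OF refl refl, THEN iffD1, rotated])
qed

section \<open>Poisson approximation and the normal limit\<close>

lemma norm_exp_minus_one_minus_le:
  fixes u :: complex
  assumes "norm u \<le> 2"
  shows "norm (exp u - 1 - u) \<le> exp 2 * (norm u)\<^sup>2"
proof -
  have "norm (exp u - 1 - u) \<le> exp \<bar>Re u\<bar> * (norm u)\<^sup>2"
    using Taylor_exp[of u 1] by (simp add: eval_nat_numeral algebra_simps)
  also have "\<dots> \<le> exp 2 * (norm u)\<^sup>2"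
    using abs_Re_le_cmod[of u] assms by (intro mult_right_mono) auto
  finally show ?thesis .
qed

lemma level_mean_le: "level_mean (Suc N) \<le> real N"
proof -
  have "bell_ratio 0 = 1"
    by (simp add: bell_ratio_def bell_0 bell_Suc_0)
  then have "1 \<le> bell_ratio N"
    using monoD[OF bell_ratio_mono, of 0 N] by simp
  then show ?thesis
    by (simp add: level_mean_eq_bell_ratio divide_le_eq mult_le_cancel_left1)
qed

lemma level_mean_nonneg: "0 \<le> level_mean (Suc N)"
  using bell_ratio_pos[of N] by (simp add: level_mean_eq_bell_ratio)

text \<open>The defining expression of \<open>rate_variance\<close> as a mean square deviation with respect to the
  mixing weights, with \<open>j + 1\<close> in the role of \<open>M\<close>.\<close>

lemma sums_rate_deviation:
  assumes "N \<ge> 2"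
  shows "(\<lambda>j. real (Suc j) ^ N / fact j * (real N / real (Suc j) - level_mean (Suc N))\<^sup>2)
     sums (exp 1 * real (bell (Suc N)) * rate_variance N)"
proof -
  define \<mu> where "\<mu> = level_mean (Suc N)"
  obtain M where N: "N = Suc (Suc M)" using le_Suc_ex[OF assms] by auto
  have "(\<lambda>j. (real N)\<^sup>2 * (real (Suc j) ^ M / fact j) - 2 * real N * \<mu> * (real (Suc j) ^ Suc M / fact j)
        + \<mu>\<^sup>2 * (real (Suc j) ^ N / fact j))
     sums ((real N)\<^sup>2 * (exp 1 * real (bell (Suc M))) - 2 * real N * \<mu> * (exp 1 * real (bell (Suc (Suc M))))
        + \<mu>\<^sup>2 * (exp 1 * real (bell (Suc N))))"
    by (intro sums_add sums_diff sums_mult dobinski_shifted)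
  moreover have "(real N)\<^sup>2 * (real (Suc j) ^ M / fact j) - 2 * real N * \<mu> * (real (Suc j) ^ Suc M / fact j)
        + \<mu>\<^sup>2 * (real (Suc j) ^ N / fact j)
     = real (Suc j) ^ N / fact j * (real N / real (Suc j) - \<mu>)\<^sup>2" for j
  proof -
    define x where "x = real (Suc j)"
    have x: "x > 0" by (simp add: x_def)
    have "x ^ N * (real N / x - \<mu>)\<^sup>2 = (real N)\<^sup>2 * x ^ M - 2 * real N * \<mu> * x ^ Suc M + \<mu>\<^sup>2 * x ^ N"
    proof -
      have "x ^ N = x ^ M * x\<^sup>2" by (simp add: N power2_eq_square)
      moreover have "x\<^sup>2 * (real N / x - \<mu>)\<^sup>2 = (real N - \<mu> * x)\<^sup>2"
        using x by (simp add: power_mult_distrib[symmetric] right_diff_distrib mult.commute)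
      ultimately have "x ^ N * (real N / x - \<mu>)\<^sup>2 = x ^ M * (real N - \<mu> * x)\<^sup>2"
        by (simp only: mult.assoc)
      also have "\<dots> = (real N)\<^sup>2 * x ^ M - 2 * real N * \<mu> * x ^ Suc M + \<mu>\<^sup>2 * (x ^ M * x\<^sup>2)"
        by (simp add: power2_eq_square algebra_simps)
      also have "x ^ M * x\<^sup>2 = x ^ N" by (simp add: N power2_eq_square)
      finally show ?thesis .
    qed
    then have "x ^ N * (real N / x - \<mu>)\<^sup>2 / fact j
        = ((real N)\<^sup>2 * x ^ M - 2 * real N * \<mu> * x ^ Suc M + \<mu>\<^sup>2 * x ^ N) / fact j"
      by (simp only:)
    then show ?thesis
      unfolding x_def[symmetric]
      by (simp only: add_divide_distrib diff_divide_distrib times_divide_eq_right times_divide_eq_left)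
  qed
  moreover have "(real N)\<^sup>2 * (exp 1 * real (bell (Suc M))) - 2 * real N * \<mu> * (exp 1 * real (bell (Suc (Suc M))))
        + \<mu>\<^sup>2 * (exp 1 * real (bell (Suc N))) = exp 1 * real (bell (Suc N)) * rate_variance N"
  proof -
    define b where "b = real (bell (Suc N))"
    have b: "b > 0" using bell_pos by (simp add: b_def)
    have "real N * real (bell (Suc (Suc M))) = \<mu> * b"
      using b by (simp add: \<mu>_def level_mean_Suc N b_def)
    then have cross: "2 * real N * \<mu> * (exp 1 * real (bell (Suc (Suc M)))) = exp 1 * b * (2 * \<mu>\<^sup>2)"
      by (simp add: power2_eq_square)
    have "b * rate_variance N = (real N)\<^sup>2 * real (bell (Suc M)) - b * \<mu>\<^sup>2"
      using b unfolding rate_variance_def \<mu>_def level_mean_Suc b_def[symmetric]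
      by (simp add: N field_simps power2_eq_square)
    then have "exp 1 * b * rate_variance N
        = exp 1 * ((real N)\<^sup>2 * real (bell (Suc M)) - b * \<mu>\<^sup>2)"
      by (simp only: mult.assoc)
    then show ?thesis
      unfolding b_def[symmetric] cross by (simp add: algebra_simps)
  qed
  ultimately show ?thesis by (simp only: \<mu>_def)
qed

text \<open>The generating function of a binomial distribution with parameters \<open>N\<close> and \<open>1 / (j + 1)\<close> is
  compared with that of a Poisson distribution with mean \<open>\<mu>\<close>.  Both are \<open>N\<close>-th powers of numbers in
  the unit disc, so their distance is at most \<open>N\<close> times the distance of the bases.  The first
  error term comes from the difference of the rates \<open>N / (j + 1)\<close> and \<open>\<mu>\<close>, the second one from
  linearising the exponential function.\<close>

lemma norm_mixture_term_le:
  fixes z :: complex and \<mu> :: real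
  assumes z: "norm z \<le> 1" and \<mu>: "0 \<le> \<mu>" "\<mu> \<le> real N" and N: "N > 0"
  shows "norm (((of_nat j + z) / of_nat (Suc j)) ^ N - exp (of_real \<mu> * (z - 1)))
    \<le> norm (z - 1) * (((real N / real (Suc j) - \<mu>)\<^sup>2 + 1) / 2)
      + exp 2 * (norm (z - 1))\<^sup>2 * \<mu>\<^sup>2 / real N"
proof -
  define x where "x = real (Suc j)"
  have x: "x > 0" by (simp add: x_def)
  define u where "u = (z - 1) * of_real (\<mu> / real N)"
  define v where "v = (of_nat j + z) / of_nat (Suc j)"
  have u_norm: "norm u = norm (z - 1) * (\<mu> / real N)"
    using \<mu> by (simp add: u_def norm_mult norm_divide)
  have "norm (z - 1) \<le> 2" using norm_triangle_ineq4[of z 1] z by simp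
  moreover have "\<mu> / real N \<le> 1" using \<mu> N by simp
  ultimately have "norm (z - 1) * (\<mu> / real N) \<le> 2 * 1" using \<mu> by (intro mult_mono) auto
  then have u2: "norm u \<le> 2" unfolding u_norm by simp
  have "Re u = (Re z - 1) * (\<mu> / real N)" by (simp add: u_def)
  also have "\<dots> \<le> 0"
    using complex_Re_le_cmod[of z] z \<mu> by (intro mult_nonpos_nonneg) auto
  finally have w: "norm (exp u) \<le> 1" by simp
  have "norm (of_nat j + z) \<le> x"
    using norm_triangle_ineq[of "of_nat j" z] z by (simp add: x_def)
  then have v: "norm v \<le> 1"
    using x by (simp add: v_def norm_divide x_def del: of_nat_Suc)
  have Nu: "of_nat N * u = of_real \<mu> * (z - 1)"
    using N by (simp add: u_def)
  have shift: "of_nat j + z = of_nat (Suc j) + (z - 1)" by simp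
  have v_eq: "v = 1 + (z - 1) / of_real x"
    unfolding v_def shift add_divide_distrib by (simp add: x_def del: of_nat_Suc)
  have split: "of_nat N * (v - exp u)
      = (z - 1) * of_real (real N / x - \<mu>) - of_nat N * (exp u - 1 - u)"
    using Nu by (simp add: v_eq algebra_simps)
  have "norm (v ^ N - exp u ^ N) \<le> real N * norm (v - exp u)"
    by (rule norm_power_diff[OF v w])
  also have "\<dots> = norm (of_nat N * (v - exp u))" by (simp add: norm_mult)
  also have "\<dots> \<le> norm ((z - 1) * of_real (real N / x - \<mu>)) + norm (of_nat N * (exp u - 1 - u))"
    unfolding split by (rule norm_triangle_ineq4)
  also have "norm ((z - 1) * of_real (real N / x - \<mu>)) \<le> norm (z - 1) * (((real N / x - \<mu>)\<^sup>2 + 1) / 2)"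
  proof -
    \<comment> \<open>Trading the absolute deviation for its square makes the bound averageable; a bounded
      average suffices because of the small factor \<open>z - 1\<close>.\<close>
    have "0 \<le> (\<bar>real N / x - \<mu>\<bar> - 1)\<^sup>2" by simp
    then have "\<bar>real N / x - \<mu>\<bar> \<le> ((real N / x - \<mu>)\<^sup>2 + 1) / 2"
      unfolding power2_diff power2_abs by simp
    then show ?thesis
      unfolding norm_mult norm_of_real by (rule mult_left_mono) simp
  qed
  also have "norm (of_nat N * (exp u - 1 - u)) \<le> real N * (exp 2 * (norm u)\<^sup>2)"
    unfolding norm_mult norm_of_nat
    by (intro mult_left_mono norm_exp_minus_one_minus_le u2) simp
  also have "real N * (exp 2 * (norm u)\<^sup>2) = exp 2 * (norm (z - 1))\<^sup>2 * \<mu>\<^sup>2 / real N"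
    unfolding u_norm using N by (simp add: power2_eq_square)
  finally show ?thesis
    unfolding v_def x_def exp_of_nat_mult[symmetric] Nu by simp
qed

text \<open>Averaging the preceding bound over the mixing weights replaces the squared deviation of the rate
  by its mean, \<open>rate_variance N\<close>.\<close>

lemma poisson_approximation:
  fixes z :: complex
  assumes z: "norm z \<le> 1" and N: "N \<ge> 2"
  defines "\<mu> \<equiv> level_mean (Suc N)"
  shows "norm (measure_pmf.expectation (uniform_partition (Suc N)) (\<lambda>P. z ^ levels (Suc N) P)
      - exp (of_real \<mu> * (z - 1)))
    \<le> norm (z - 1) * ((rate_variance N + 1) / 2)
      + exp 2 * (norm (z - 1))\<^sup>2 * (\<mu>\<^sup>2 / real N)"
proof -
  define b where "b = real (bell (Suc N))"
  have b: "b > 0" using bell_pos by (simp add: b_def)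
  define G where "G = (\<Sum>P\<in>set_partitions (Suc N). z ^ levels (Suc N) P)"
  define w where "w = exp (of_real \<mu> * (z - 1))"
  define C where "C = exp 2 * (norm (z - 1))\<^sup>2 * (\<mu>\<^sup>2 / real N)"
  define q where "q = (\<lambda>j. real (Suc j) ^ N / fact j)"
  have \<mu>: "0 \<le> \<mu>" "\<mu> \<le> real N" unfolding \<mu>_def by (rule level_mean_nonneg level_mean_le)+
  have q: "q sums (exp 1 * b)"
    unfolding q_def b_def by (rule dobinski_shifted)
  have S1: "(\<lambda>j. (of_nat j + z) ^ N / fact j - w * of_real (q j))
      sums (exp 1 * G - w * of_real (exp 1 * b))"
    unfolding G_def by (intro sums_diff levels_dobinski sums_mult sums_of_real q)
  have S2: "(\<lambda>j. norm (z - 1) / 2 * (q j * (real N / real (Suc j) - \<mu>)\<^sup>2)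
        + (norm (z - 1) / 2 + C) * q j)
      sums (norm (z - 1) / 2 * (exp 1 * b * rate_variance N)
        + (norm (z - 1) / 2 + C) * (exp 1 * b))"
    unfolding q_def b_def \<mu>_def
    by (intro sums_add sums_mult sums_rate_deviation N dobinski_shifted)
  have le: "norm ((of_nat j + z) ^ N / fact j - w * of_real (q j))
      \<le> norm (z - 1) / 2 * (q j * (real N / real (Suc j) - \<mu>)\<^sup>2)
        + (norm (z - 1) / 2 + C) * q j" for j
  proof -
    have q0: "q j \<ge> 0" by (simp add: q_def)
    have eq: "(of_nat j + z) ^ N / fact j = of_real (q j) * ((of_nat j + z) / of_nat (Suc j)) ^ N"
      by (simp add: q_def power_divide del: of_nat_Suc)
    have "norm ((of_nat j + z) ^ N / fact j - w * of_real (q j))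
       = q j * norm (((of_nat j + z) / of_nat (Suc j)) ^ N - w)"
    proof -
      have "of_real (q j) * v - w * of_real (q j) = of_real (q j) * (v - w)" for v
        by (simp add: algebra_simps)
      then show ?thesis unfolding eq using q0 by (simp only: norm_mult norm_of_real abs_of_nonneg)
    qed
    also have "\<dots> \<le> q j * (norm (z - 1) * (((real N / real (Suc j) - \<mu>)\<^sup>2 + 1) / 2) + C)"
      unfolding w_def C_def
      using norm_mixture_term_le[OF z \<mu>, of j] N q0 by (intro mult_left_mono) auto
    also have "\<dots> = norm (z - 1) / 2 * (q j * (real N / real (Suc j) - \<mu>)\<^sup>2)
        + (norm (z - 1) / 2 + C) * q j"
      by (simp add: algebra_simps add_divide_distrib del: of_nat_Suc)
    finally show ?thesis .
  qed
  have "norm (exp 1 * G - w * of_real (exp 1 * b))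
     \<le> norm (z - 1) / 2 * (exp 1 * b * rate_variance N) + (norm (z - 1) / 2 + C) * (exp 1 * b)"
    using norm_suminf_le[OF le sums_summable[OF S2]]
    unfolding sums_unique[OF S1, symmetric] sums_unique[OF S2, symmetric] .
  also have "\<dots> = exp 1 * b * (norm (z - 1) * ((rate_variance N + 1) / 2) + C)"
    by (simp add: algebra_simps add_divide_distrib)
  also have "exp 1 * G - w * of_real (exp 1 * b) = of_real (exp 1 * b) * (G / of_real b - w)"
  proof -
    have "of_real (exp 1) = (exp 1 :: complex)" by (simp flip: exp_of_real)
    then show ?thesis using b by (simp add: algebra_simps)
  qed
  also have "norm \<dots> = exp 1 * b * norm (G / of_real b - w)"
    using b by (simp add: norm_mult)
  finally have "norm (G / of_real b - w) \<le> norm (z - 1) * ((rate_variance N + 1) / 2) + C"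
    using b by (simp add: mult_le_cancel_left_pos)
  moreover have "measure_pmf.expectation (uniform_partition (Suc N)) (\<lambda>P. z ^ levels (Suc N) P)
      = G / of_real b"
    by (simp add: expectation_uniform_partition G_def b_def scaleR_conv_of_real)
  ultimately show ?thesis unfolding w_def C_def by simp
qed

lemma level_mean_sq_over_index: "(\<lambda>N. (level_mean (Suc N))\<^sup>2 / real N) \<longlonglongrightarrow> 0"
proof -
  have "(\<lambda>N. (level_mean (Suc N) / ln (real (Suc N)))\<^sup>2 * ((ln (real (Suc N)))\<^sup>2 / real N))
      \<longlonglongrightarrow> 1\<^sup>2 * 0"
    by (intro tendsto_mult tendsto_power filterlim_compose[OF level_mean_over_ln filterlim_Suc])
       real_asymp
  moreover have "\<forall>\<^sub>F N in sequentially.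
      (level_mean (Suc N) / ln (real (Suc N)))\<^sup>2 * ((ln (real (Suc N)))\<^sup>2 / real N)
      = (level_mean (Suc N))\<^sup>2 / real N"
    using eventually_gt_at_top[of 0]
  proof eventually_elim
    case (elim N)
    then have "ln (real (Suc N)) > 0" by (intro ln_gt_zero) simp
    then show ?case by (simp add: power_divide del: of_nat_Suc)
  qed
  ultimately show ?thesis unfolding mult_zero_right by (rule Lim_transform_eventually)
qed

text \<open>The characteristic function of a centred Poisson variable with mean \<open>m\<close>, evaluated at
  \<open>s\<close>: the cubic remainder of \<open>iexp s\<close> is negligible since \<open>m \<bar>s\<bar> ^ 3 = (m s\<^sup>2) \<bar>s\<bar>\<close>.\<close>

lemma tendsto_exp_centred_poisson:
  fixes m s :: "nat \<Rightarrow> real"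
  assumes s: "s \<longlonglongrightarrow> 0" and ms: "(\<lambda>n. m n * (s n)\<^sup>2) \<longlonglongrightarrow> c"
  shows "(\<lambda>n. exp (of_real (m n) * (iexp (s n) - 1 - \<i> * of_real (s n))))
     \<longlonglongrightarrow> exp (of_real (- c / 2) :: complex)"
proof -
  have sum_le_2: "(\<Sum>k\<le>2. f k) = f 0 + f 1 + f 2" for f :: "nat \<Rightarrow> complex"
    by (simp add: numeral_2_eq_2)
  define R where "R n = of_real (m n) * (iexp (s n) - 1 - \<i> * of_real (s n) + of_real ((s n)\<^sup>2 / 2))" for n
  have "R \<longlonglongrightarrow> 0"
  proof (rule Lim_null_comparison)
    have "(\<lambda>n. \<bar>m n * (s n)\<^sup>2\<bar> * (\<bar>s n\<bar> / 6)) \<longlonglongrightarrow> \<bar>c\<bar> * (\<bar>0\<bar> / 6)"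
      by (intro tendsto_mult tendsto_rabs tendsto_divide s ms tendsto_const) simp
    then show "(\<lambda>n. \<bar>m n * (s n)\<^sup>2\<bar> * (\<bar>s n\<bar> / 6)) \<longlonglongrightarrow> 0" by simp
    show "\<forall>\<^sub>F n in sequentially. norm (R n) \<le> \<bar>m n * (s n)\<^sup>2\<bar> * (\<bar>s n\<bar> / 6)"
    proof (rule always_eventually, rule allI)
      fix n
      have "(\<Sum>k\<le>2. (\<i> * of_real (s n)) ^ k / fact k) = 1 + \<i> * of_real (s n) - of_real ((s n)\<^sup>2 / 2)"
        by (simp add: sum_le_2 power_mult_distrib)
      then have "norm (iexp (s n) - 1 - \<i> * of_real (s n) + of_real ((s n)\<^sup>2 / 2)) \<le> \<bar>s n\<bar> ^ 3 / 6"
        using iexp_approx1[of "s n" 2] by (simp add: algebra_simps eval_nat_numeral)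
      then have "norm (R n) \<le> \<bar>m n\<bar> * (\<bar>s n\<bar> ^ 3 / 6)"
        unfolding R_def norm_mult norm_of_real by (rule mult_left_mono) simp
      then show "norm (R n) \<le> \<bar>m n * (s n)\<^sup>2\<bar> * (\<bar>s n\<bar> / 6)"
        by (simp add: abs_mult power3_eq_cube power2_eq_square mult_ac)
    qed
  qed
  then have "(\<lambda>n. R n + of_real (- (m n * (s n)\<^sup>2) / 2)) \<longlonglongrightarrow> 0 + of_real (- c / 2)"
    by (intro tendsto_add tendsto_of_real tendsto_divide tendsto_minus ms tendsto_const) simp_all
  moreover have "R n + of_real (- (m n * (s n)\<^sup>2) / 2)
      = of_real (m n) * (iexp (s n) - 1 - \<i> * of_real (s n))" for n
    by (simp add: R_def algebra_simps)
  ultimately show ?thesis by (intro tendsto_exp) simp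
qed

abbreviation (input) normalized_levels :: "nat \<Rightarrow> nat set set \<Rightarrow> real" where
  "normalized_levels n P \<equiv> (real (levels n P) - level_mean n) / level_sd n"

lemma char_normalized_levels:
  fixes t :: real
  defines "s \<equiv> \<lambda>n. t / level_sd n"
  shows "char (distr (uniform_partition n) borel (normalized_levels n)) t
     = iexp (- (s n * level_mean n))
       * measure_pmf.expectation (uniform_partition n) (\<lambda>P. iexp (s n) ^ levels n P)"
proof -
  have "char (distr (uniform_partition n) borel (normalized_levels n)) t
     = measure_pmf.expectation (uniform_partition n) (\<lambda>P. iexp (t * normalized_levels n P))"
    unfolding char_def by (subst integral_distr) auto
  also have "(\<lambda>P. iexp (t * normalized_levels n P))
     = (\<lambda>P. iexp (- (s n * level_mean n)) * iexp (s n) ^ levels n P)"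
  proof
    fix P
    have "t * normalized_levels n P = - (s n * level_mean n) + real (levels n P) * s n"
      by (simp add: s_def diff_divide_distrib algebra_simps)
    then have "iexp (t * normalized_levels n P)
      = exp (\<i> * of_real (- (s n * level_mean n)) + of_nat (levels n P) * (\<i> * of_real (s n)))"
      by (simp only: of_real_add of_real_mult of_real_of_nat_eq distrib_left mult.left_commute)
    then show "iexp (t * normalized_levels n P)
      = iexp (- (s n * level_mean n)) * iexp (s n) ^ levels n P"
      by (simp only: exp_add exp_of_nat_mult)
  qed
  also have "measure_pmf.expectation (uniform_partition n) \<dots> = iexp (- (s n * level_mean n))
       * measure_pmf.expectation (uniform_partition n) (\<lambda>P. iexp (s n) ^ levels n P)"
    by simp
  finally show ?thesis .
qed

text \<open>At \<open>s = t / \<sigma>\<close> the generating function of the levels may be replaced by the Poisson one, as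
  \<open>iexp s \<rightarrow> 1\<close>; and \<open>\<mu> s\<^sup>2 \<rightarrow> t\<^sup>2\<close> because mean and variance are asymptotically equal.\<close>

lemma char_normalized_levels_tendsto:
  "(\<lambda>n. char (distr (uniform_partition n) borel (normalized_levels n)) t)
     \<longlonglongrightarrow> char std_normal_distribution t"
proof (rule LIMSEQ_offset[where k = 1])
  define s where "s N = t / level_sd (Suc N)" for N
  define m where "m N = level_mean (Suc N)" for N
  define E where "E N = measure_pmf.expectation (uniform_partition (Suc N)) (\<lambda>P. iexp (s N) ^ levels (Suc N) P)" for N
  have sd: "filterlim (\<lambda>N. level_sd (Suc N)) at_top sequentially"
    unfolding level_sd_def by (rule filterlim_compose[OF sqrt_at_top level_variance_at_top])
  have s: "s \<longlonglongrightarrow> 0"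
    unfolding s_def by (rule real_tendsto_divide_at_top[OF tendsto_const sd])
  have "(\<lambda>N. t\<^sup>2 * inverse (level_variance (Suc N) / level_mean (Suc N))) \<longlonglongrightarrow> t\<^sup>2 * inverse 1"
    by (intro tendsto_mult tendsto_inverse level_variance_over_mean tendsto_const) simp
  moreover have "\<forall>\<^sub>F N in sequentially.
      t\<^sup>2 * inverse (level_variance (Suc N) / level_mean (Suc N)) = m N * (s N)\<^sup>2"
    using eventually_compose_filterlim[OF eventually_gt_at_top[of "0::real"] level_variance_at_top]
    by eventually_elim (simp add: m_def s_def level_sd_def power_divide)
  ultimately have ms: "(\<lambda>N. m N * (s N)\<^sup>2) \<longlonglongrightarrow> t\<^sup>2 * inverse 1"
    by (rule Lim_transform_eventually)
  have z: "(\<lambda>N. norm (iexp (s N) - 1)) \<longlonglongrightarrow> 0"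
  proof -
    have "(\<lambda>N. norm (iexp (s N) - 1)) \<longlonglongrightarrow> norm (iexp 0 - 1)"
      by (intro tendsto_norm tendsto_diff tendsto_exp tendsto_mult tendsto_of_real s tendsto_const)
    then show ?thesis by simp
  qed
  have diff: "(\<lambda>N. E N - exp (of_real (m N) * (iexp (s N) - 1))) \<longlonglongrightarrow> 0"
  proof (rule Lim_null_comparison)
    show "\<forall>\<^sub>F N in sequentially. norm (E N - exp (of_real (m N) * (iexp (s N) - 1)))
       \<le> norm (iexp (s N) - 1) * ((rate_variance N + 1) / 2)
      + exp 2 * (norm (iexp (s N) - 1))\<^sup>2 * ((level_mean (Suc N))\<^sup>2 / real N)"
      using eventually_ge_at_top[of 2]
      by eventually_elim (unfold E_def m_def, rule poisson_approximation, auto)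
    have "(\<lambda>N. norm (iexp (s N) - 1) * ((rate_variance N + 1) / 2)
      + exp 2 * (norm (iexp (s N) - 1))\<^sup>2 * ((level_mean (Suc N))\<^sup>2 / real N))
      \<longlonglongrightarrow> 0 * ((0 + 1) / 2) + exp 2 * 0\<^sup>2 * 0"
      by (intro tendsto_intros z rate_variance_tendsto level_mean_sq_over_index) simp
    then show "(\<lambda>N. norm (iexp (s N) - 1) * ((rate_variance N + 1) / 2)
      + exp 2 * (norm (iexp (s N) - 1))\<^sup>2 * ((level_mean (Suc N))\<^sup>2 / real N)) \<longlonglongrightarrow> 0"
      by simp
  qed
  have "(\<lambda>N. iexp (- (s N * m N)) * (E N - exp (of_real (m N) * (iexp (s N) - 1)))) \<longlonglongrightarrow> 0"
    by (rule tendsto_norm_zero_cancel)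
       (use tendsto_norm_zero[OF diff] in \<open>simp add: norm_mult\<close>)
  then have "(\<lambda>N. iexp (- (s N * m N)) * (E N - exp (of_real (m N) * (iexp (s N) - 1)))
      + exp (of_real (m N) * (iexp (s N) - 1 - \<i> * of_real (s N))))
      \<longlonglongrightarrow> 0 + exp (of_real (- (t\<^sup>2 * inverse 1) / 2))"
    by (intro tendsto_add tendsto_exp_centred_poisson s ms)
  moreover have "iexp (- (s N * m N)) * (E N - exp (of_real (m N) * (iexp (s N) - 1)))
      + exp (of_real (m N) * (iexp (s N) - 1 - \<i> * of_real (s N)))
      = char (distr (uniform_partition (N + 1)) borel (normalized_levels (N + 1))) t" for N
  proof -
    have "exp (of_real (m N) * (iexp (s N) - 1 - \<i> * of_real (s N)))
        = iexp (- (s N * m N)) * exp (of_real (m N) * (iexp (s N) - 1))"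
      by (simp add: exp_add[symmetric] algebra_simps)
    moreover have "char (distr (uniform_partition (N + 1)) borel (normalized_levels (N + 1))) t
        = iexp (- (s N * m N)) * E N"
      unfolding char_normalized_levels by (simp add: s_def m_def E_def)
    ultimately show ?thesis by (simp add: right_diff_distrib)
  qed
  ultimately show "(\<lambda>N. char (distr (uniform_partition (N + 1)) borel (normalized_levels (N + 1))) t)
     \<longlonglongrightarrow> char std_normal_distribution t"
    by (simp add: char_std_normal_distribution flip: exp_of_real)
qed

lemma cdf_std_normal_distribution:
  "cdf std_normal_distribution x = 1 / sqrt (2 * pi) * (LINT t:{..x}|lborel. exp (- t\<^sup>2 / 2))"
proof -
  interpret real_distribution std_normal_distribution by (rule real_dist_normal_dist)
  have "cdf std_normal_distribution x = (LINT t|std_normal_distribution. indicator {..x} t)"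
    by (simp add: cdf_def)
  also have "\<dots> = (LINT t|lborel. std_normal_density t * indicator {..x} t)"
    by (subst integral_density) auto
  also have "\<dots> = (LINT t|lborel. 1 / sqrt (2 * pi) * (indicator {..x} t *\<^sub>R exp (- t\<^sup>2 / 2)))"
    by (simp add: std_normal_density_def mult_ac)
  also have "\<dots> = 1 / sqrt (2 * pi) * (LINT t:{..x}|lborel. exp (- t\<^sup>2 / 2))"
    unfolding set_lebesgue_integral_def by (rule integral_mult_right_zero)
  finally show ?thesis .
qed

lemma isCont_cdf_std_normal_distribution: "isCont (cdf std_normal_distribution) x"
proof -
  interpret real_distribution std_normal_distribution by (rule real_dist_normal_dist)
  have "emeasure std_normal_distribution {x}
      = (\<integral>\<^sup>+t. ennreal (std_normal_density t) * indicator {x} t \<partial>lborel)"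
    by (rule emeasure_density) auto
  also have "\<dots> = (\<integral>\<^sup>+(t::real). 0 \<partial>lborel)"
  proof (rule nn_integral_cong_AE)
    show "AE t in lborel. ennreal (std_normal_density t) * indicator {x} t = 0"
      using AE_lborel_singleton[of x] by eventually_elim simp
  qed
  finally have "emeasure std_normal_distribution {x} = 0" by simp
  then have "measure std_normal_distribution {x} = 0"
    by (simp add: measure_def)
  then show ?thesis by (simp add: isCont_cdf)
qed

(* The middle term of the variance has coefficient (n-1)(n-2): it is the second factorial
   moment of the number of levels, i.e. a sum over the (n-1)(n-2) ordered pairs of distinct
   positions.  With n(n-1) in its place the identity fails: for n = 2 the number of levels is
   0 or 1 with probability 1/2 each, so its variance is 1/4 and not 5/4. *)

theorem theorem1p1:
  shows "(\<forall>n\<ge>1. level_mean n = (real n - 1) * real (bell (n - 1)) / real (bell n))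
    \<and> level_mean \<sim>[sequentially] (\<lambda>n. ln (real n))
    \<and> (\<forall>n\<ge>2. level_variance n =
          (real n - 1) * real (bell (n - 1)) / real (bell n)
          + (real n - 1) * (real n - 2) * real (bell (n - 2)) / real (bell n)
          - (real n - 1)\<^sup>2 * (real (bell (n - 1)))\<^sup>2 / (real (bell n))\<^sup>2)
    \<and> level_variance \<sim>[sequentially] (\<lambda>n. ln (real n))
    \<and> (\<forall>x::real.
          (\<lambda>n. measure_pmf.prob (uniform_partition n)
                 {P. (real (levels n P) - level_mean n) / level_sd n \<le> x})
          \<longlonglongrightarrow> 1 / sqrt (2 * pi) * (LINT t:{..x}|lborel. exp (- t\<^sup>2 / 2)))"
proof (intro conjI allI impI)
  fix n :: nat assume "n \<ge> 1"
  then obtain N where "n = Suc N" by (cases n) auto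
  then show "level_mean n = (real n - 1) * real (bell (n - 1)) / real (bell n)"
    by (simp add: level_mean_Suc)
next
  show "level_mean \<sim>[sequentially] (\<lambda>n. ln (real n))"
    by (rule asymp_equivI'[OF level_mean_over_ln])
next
  fix n :: nat assume "n \<ge> 2"
  then obtain N where "n = Suc N" "N \<ge> 1" by (cases n) auto
  then show "level_variance n =
          (real n - 1) * real (bell (n - 1)) / real (bell n)
          + (real n - 1) * (real n - 2) * real (bell (n - 2)) / real (bell n)
          - (real n - 1)\<^sup>2 * (real (bell (n - 1)))\<^sup>2 / (real (bell n))\<^sup>2"
    by (simp add: level_variance_Suc numeral_2_eq_2)
next
  show "level_variance \<sim>[sequentially] (\<lambda>n. ln (real n))"
    by (rule asymp_equivI'[OF level_variance_over_ln])
next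
  fix x :: real
  have "weak_conv_m (\<lambda>n. distr (uniform_partition n) borel (normalized_levels n)) std_normal_distribution"
    by (rule levy_continuity[OF _ real_dist_normal_dist char_normalized_levels_tendsto])
       (intro prob_space.real_distribution_distr[OF prob_space_measure_pmf], simp)
  then have "(\<lambda>n. cdf (distr (uniform_partition n) borel (normalized_levels n)) x)
      \<longlonglongrightarrow> cdf std_normal_distribution x"
    using isCont_cdf_std_normal_distribution by (simp add: weak_conv_m_def weak_conv_def)
  then show "(\<lambda>n. measure_pmf.prob (uniform_partition n)
                 {P. (real (levels n P) - level_mean n) / level_sd n \<le> x})
          \<longlonglongrightarrow> 1 / sqrt (2 * pi) * (LINT t:{..x}|lborel. exp (- t\<^sup>2 / 2))"
    unfolding cdf_std_normal_distribution by (simp add: cdf_def measure_distr vimage_def)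
qed

end
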